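(* Let $\mathcal{Q}$ be the space of quadrilaterals modulo similarity, topologized as a subset of $\mathbb{R}^4$ via the parameterization described in the context. For every rectangle $r\in\mathcal{Q}$ there exists an open set $U\subset\mathcal{Q}$ with $r\in U$ such that every quadrilateral in $U$ has a periodic billiard path.
   Context: Parameterization of $\mathcal{Q}$: a quadrilateral is cut by one of its diagonals into two triangles. Each triangle is determined up to similarity by its two angles at the endpoints of the diagonal. The four angles between the diagonal and the four sides, $(a,b,c,d)$, therefore determine the quadrilateral up to similarity, and $\mathcal{Q}$ is regarded as a subset of $\mathbb{R}^4$ in this way. The rectangles form the set $\{(a,b,c,d): a=c,\ b=d,\ a+b=\pi/2\}$. A billiard path in a polygon is the trajectory of a point that moves in straight lines inside the polygon and reflects off the sides with angle of incidence equal to angle of reflection. Trajectories that hit a vertex are excluded. A billiard path is periodic if it repeats itself. *)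

theory Defs
  imports "HOL-Analysis.Analysis"
begin

text \<open>Parameter space: a point (a,b,c,d) of R^4. The quadrilateral P Q R S is cut by
the diagonal P R. Triangle P Q R has angle a at P and angle b at R; triangle P R S has
angle c at R and angle d at P. Thus a, b, c, d are the angles between the diagonal and
the sides PQ, QR, RS, SP respectively.\<close>

definition quad_space :: "(real \<times> real \<times> real \<times> real) set" where
  "quad_space = {(a,b,c,d). 0 < a \<and> 0 < b \<and> 0 < c \<and> 0 < d \<and> a + b < pi \<and> c + d < pi}"

definition is_rectangle :: "real \<times> real \<times> real \<times> real \<Rightarrow> bool" where
  "is_rectangle r = (case r of (a,b,c,d) \<Rightarrow> a = c \<and> b = d \<and> a + b = pi / 2)"

text \<open>Normalized representative in the complex plane: P = 0, R = 1, Q in the upper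
half plane, S in the lower half plane (law of sines).\<close>

definition quad_P :: "real \<times> real \<times> real \<times> real \<Rightarrow> complex" where
  "quad_P r = 0"
definition quad_R :: "real \<times> real \<times> real \<times> real \<Rightarrow> complex" where
  "quad_R r = 1"
definition quad_Q :: "real \<times> real \<times> real \<times> real \<Rightarrow> complex" where
  "quad_Q r = (case r of (a,b,c,d) \<Rightarrow> complex_of_real (sin b / sin (a + b)) * cis a)"
definition quad_S :: "real \<times> real \<times> real \<times> real \<Rightarrow> complex" where
  "quad_S r = (case r of (a,b,c,d) \<Rightarrow> complex_of_real (sin c / sin (c + d)) * cis (- d))"

definition quad_sides :: "real \<times> real \<times> real \<times> real \<Rightarrow> (complex \<times> complex) set" where
  "quad_sides r = {(quad_P r, quad_Q r), (quad_Q r, quad_R r), (quad_R r, quad_S r), (quad_S r, quad_P r)}"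

definition quad_region :: "real \<times> real \<times> real \<times> real \<Rightarrow> complex set" where
  "quad_region r = convex hull {quad_P r, quad_Q r, quad_R r} \<union> convex hull {quad_P r, quad_R r, quad_S r}"

definition reflect_dir :: "complex \<Rightarrow> complex \<Rightarrow> complex" where
  "reflect_dir u v = (sgn u)\<^sup>2 * cnj v"

definition periodic_billiard_path ::
  "complex set \<Rightarrow> (complex \<times> complex) set \<Rightarrow> (nat \<Rightarrow> complex) \<Rightarrow> nat \<Rightarrow> bool" where
  "periodic_billiard_path K sides p n \<longleftrightarrow>
     2 \<le> n \<and> (\<forall>i. p (i + n) = p i) \<and>
     (\<forall>i. \<exists>(x, y) \<in> sides.
          p (i + 1) \<in> open_segment x y \<and>
          p i \<noteq> p (i + 1) \<and>
          open_segment (p i) (p (i + 1)) \<subseteq> interior K \<and>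
          sgn (p (i + 2) - p (i + 1)) = reflect_dir (y - x) (sgn (p (i + 1) - p i)))"

definition has_periodic_billiard_path :: "real \<times> real \<times> real \<times> real \<Rightarrow> bool" where
  "has_periodic_billiard_path r \<longleftrightarrow>
     (\<exists>p n. periodic_billiard_path (quad_region r) (quad_sides r) p n)"

end

theory Submission
  imports Defs
begin

text \<open>
Let the interior angles of a quadrilateral near the given rectangle be \<open>pi/2 + \<alpha>\<^sub>i\<close>, so that
the \<open>\<alpha>\<^sub>i\<close> sum to 0. If they all vanish, the quadrilateral is a rectangle and a path bounces
between two opposite sides. Otherwise some \<open>\<alpha>\<^sub>i = - a\<close> is negative, and as the other three sum to
\<open>a\<close>, one of them, \<open>c\<close>, satisfies \<open>3 c \<le> a\<close>. The path then runs close to the side or diagonal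
(the slit) joining these two vertices. In the double of the quadrilateral, a neighbourhood of the
slit is a flat disc with two cone points of angles \<open>pi - 2 a\<close> and \<open>pi + 2 c\<close>, so only \<open>a\<close>
and \<open>c\<close> decide whether a closed geodesic with prescribed combinatorics exists. Four
combinatorial types, for \<open>c < 0\<close>, \<open>c = 0\<close>, \<open>0 < 3 c < a\<close> and \<open>3 c = a\<close>, cover all cases.
They do so however small \<open>a\<close> and \<open>c\<close> are, because the two borderline types are not
perturbed: they are used exactly on the loci where their holonomy vanishes.
\<close>

section \<open>Convex quadrilaterals and unfolding\<close>

definition cross :: "complex \<Rightarrow> complex \<Rightarrow> real" where
  "cross u v = Im (cnj u * v)"

lemma cross_alt: "cross u v = Re u * Im v - Im u * Re v"
  by (simp add: cross_def)

text \<open>For four points, left turns at all corners already mean a strictly convex quadrilateral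
  in counterclockwise order: the exterior angles lie between 0 and pi, so the boundary winds
  once.\<close>

definition convex_quad :: "complex \<Rightarrow> complex \<Rightarrow> complex \<Rightarrow> complex \<Rightarrow> bool" where
  "convex_quad A B C D \<longleftrightarrow> cross (B - A) (C - A) > 0 \<and> cross (C - B) (D - B) > 0 \<and>
     cross (D - C) (A - C) > 0 \<and> cross (A - D) (B - D) > 0"

text \<open>Encoded by four sign conditions rather than as the interior of a hull, so that chords
  are placed by linear inequalities and the set is its own interior.\<close>

definition inner_quad :: "complex \<Rightarrow> complex \<Rightarrow> complex \<Rightarrow> complex \<Rightarrow> complex set" where
  "inner_quad A B C D = {z. cross (B - A) (z - A) > 0 \<and> cross (C - B) (z - B) > 0 \<and>
     cross (D - C) (z - C) > 0 \<and> cross (A - D) (z - D) > 0}"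

definition cyclic_sides :: "complex \<Rightarrow> complex \<Rightarrow> complex \<Rightarrow> complex \<Rightarrow> (complex \<times> complex) set" where
  "cyclic_sides A B C D = {(A, B), (B, C), (C, D), (D, A)}"

definition billiard_quad :: "complex \<Rightarrow> complex \<Rightarrow> complex \<Rightarrow> complex \<Rightarrow> bool" where
  "billiard_quad A B C D \<longleftrightarrow>
     (\<exists>p n. periodic_billiard_path (inner_quad A B C D) (cyclic_sides A B C D) p n)"

lemma open_inner_quad: "open (inner_quad A B C D)"
  unfolding inner_quad_def cross_def
  by (intro open_Collect_conj open_Collect_less continuous_intros)

lemma interior_inner_quad [simp]: "interior (inner_quad A B C D) = inner_quad A B C D"
  by (simp add: open_inner_quad interior_open)

lemma cross_cyc: "cross (y - x) (z - x) = cross (z - y) (x - y)"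
  by (simp add: cross_alt algebra_simps)

lemma convex_quad_distinct:
  assumes "convex_quad A B C D"
  shows "distinct [A, B, C, D]"
  using assms by (auto simp: convex_quad_def cross_alt)

lemma cross_affine:
  assumes "z = (1 - u) *\<^sub>R x + u *\<^sub>R y"
  shows "cross v (z - w) = (1 - u) * cross v (x - w) + u * cross v (y - w)"
  unfolding assms cross_alt by (simp add: algebra_simps)

lemma cross_side_nonneg:
  assumes q: "convex_quad A B C D" and s: "(x, y) \<in> cyclic_sides A B C D"
    and v: "w \<in> {A, B, C, D}"
  shows "cross (y - x) (w - x) \<ge> 0" and "w \<noteq> x \<Longrightarrow> w \<noteq> y \<Longrightarrow> cross (y - x) (w - x) > 0"
proof -
  have c: "cross (B - A) (C - A) > 0" "cross (C - B) (D - B) > 0"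
     "cross (D - C) (A - C) > 0" "cross (A - D) (B - D) > 0"
     "cross (C - B) (A - B) > 0" "cross (D - C) (B - C) > 0"
     "cross (A - D) (C - D) > 0" "cross (B - A) (D - A) > 0"
    using q cross_cyc[of B A C] cross_cyc[of C B D] cross_cyc[of D C A] cross_cyc[of A D B]
    by (auto simp: convex_quad_def)
  have z: "cross u u = 0" "cross u 0 = 0" for u
    by (simp_all add: cross_alt)
  show "w \<noteq> x \<Longrightarrow> w \<noteq> y \<Longrightarrow> cross (y - x) (w - x) > 0"
    using s v c by (auto simp: cyclic_sides_def)
  then show "cross (y - x) (w - x) \<ge> 0"
    by (cases "w = x \<or> w = y") (auto simp: z)
qed

text \<open>Two different sides share at most one vertex, so the second has an endpoint strictly to
  the left of the first, and an interior point gives that endpoint positive weight.\<close>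

lemma cross_open_side:
  assumes q: "convex_quad A B C D" and s: "(x, y) \<in> cyclic_sides A B C D"
    and s': "(x', y') \<in> cyclic_sides A B C D" and ne: "(x, y) \<noteq> (x', y')"
    and p: "p \<in> open_segment x' y'"
  shows "cross (y - x) (p - x) > 0"
proof -
  obtain u where u: "0 < u" "u < 1" "p = (1 - u) *\<^sub>R x' + u *\<^sub>R y'"
    using p by (auto simp: in_segment)
  have v: "x' \<in> {A, B, C, D}" "y' \<in> {A, B, C, D}"
    using s' by (auto simp: cyclic_sides_def)
  have "x' \<noteq> x \<and> x' \<noteq> y \<or> y' \<noteq> x \<and> y' \<noteq> y"
    using convex_quad_distinct[OF q] s s' ne by (auto simp: cyclic_sides_def)
  then have "cross (y - x) (x' - x) > 0 \<or> cross (y - x) (y' - x) > 0"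
    using cross_side_nonneg(2)[OF q s v(1)] cross_side_nonneg(2)[OF q s v(2)] by blast
  moreover have "cross (y - x) (x' - x) \<ge> 0" "cross (y - x) (y' - x) \<ge> 0"
    using cross_side_nonneg(1)[OF q s] v by blast+
  ultimately show ?thesis
    unfolding cross_affine[OF u(3)] using u(1,2)
    by (auto intro: add_pos_nonneg add_nonneg_pos)
qed

lemma cross_own_side:
  assumes "p \<in> open_segment x y"
  shows "cross (y - x) (p - x) = 0"
proof -
  obtain u where u: "p = (1 - u) *\<^sub>R x + u *\<^sub>R y"
    using assms by (auto simp: in_segment)
  show ?thesis
    unfolding cross_affine[OF u] by (simp add: cross_alt)
qed

lemma inner_quad_iff:
  "z \<in> inner_quad A B C D \<longleftrightarrow> (\<forall>(x, y) \<in> cyclic_sides A B C D. cross (y - x) (z - x) > 0)"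
  by (auto simp: inner_quad_def cyclic_sides_def)

text \<open>Both ends of the chord lie weakly to the left of every side line, and as they belong to
  different sides, no side line contains both.\<close>

lemma open_segment_inner_quad:
  assumes q: "convex_quad A B C D"
    and s: "(x, y) \<in> cyclic_sides A B C D" and s': "(x', y') \<in> cyclic_sides A B C D"
    and ne: "(x, y) \<noteq> (x', y')"
    and p: "p \<in> open_segment x y" and p': "p' \<in> open_segment x' y'"
  shows "open_segment p p' \<subseteq> inner_quad A B C D"
proof
  fix z assume "z \<in> open_segment p p'"
  then obtain u where u: "0 < u" "u < 1" "z = (1 - u) *\<^sub>R p + u *\<^sub>R p'"
    by (auto simp: in_segment)
  have "cross (w - v) (z - v) > 0" if vw: "(v, w) \<in> cyclic_sides A B C D" for v w
  proof -
    have "cross (w - v) (p - v) > 0 \<or> cross (w - v) (p - v) = 0 \<and> (v, w) = (x, y)"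
      using cross_open_side[OF q vw s _ p] cross_own_side[OF p] by auto
    moreover have "cross (w - v) (p' - v) > 0 \<or> cross (w - v) (p' - v) = 0 \<and> (v, w) = (x', y')"
      using cross_open_side[OF q vw s' _ p'] cross_own_side[OF p'] by auto
    ultimately show ?thesis
      unfolding cross_affine[OF u(3)] using u(1,2) ne
      by (auto intro: add_pos_pos)
  qed
  then show "z \<in> inner_quad A B C D"
    unfolding inner_quad_iff by blast
qed

section \<open>Unfolding a billiard path to a straight line\<close>

lemma reflect_dir_minus: "reflect_dir (- u) v = reflect_dir u v"
  by (simp add: reflect_dir_def sgn_minus)

text \<open>Up to a complex factor this is the linear part of a similarity, orientation preserving
  iff \<open>s\<close> holds.\<close>

definition flip :: "bool \<Rightarrow> complex \<Rightarrow> complex" where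
  "flip s z = (if s then z else cnj z)"

lemma flip_simps [simp]: "flip s (x + y) = flip s x + flip s y" "flip s (x - y) = flip s x - flip s y"
  "flip s (c *\<^sub>R x) = c *\<^sub>R flip s x" "flip s (flip s x) = x"
  by (simp_all add: flip_def)

lemma sgn_flip: "sgn (flip s z) = flip s (sgn z)"
  by (simp add: flip_def sgn_eq)

lemma inverse_unit_complex: "cmod z = 1 \<Longrightarrow> inverse z = cnj z"
  by (metis complex_norm_square inverse_unique of_real_1 power_one)

text \<open>A billiard path unfolds to the horizontal line through the copies \<open>G i\<close> of the
quadrilateral: \<open>G i\<close> and \<open>G (Suc i)\<close> are mirror images in their common side, whose
endpoints \<open>l i\<close> and \<open>r i\<close> lie above and below the line.\<close>

lemma periodic_path_of_unfolding:
  fixes l r \<alpha> \<beta> :: "nat \<Rightarrow> complex" and s :: "nat \<Rightarrow> bool"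
  defines "G \<equiv> \<lambda>i z. \<beta> i + \<alpha> i * flip (s i) z"
  assumes q: "convex_quad A B C D" and N: "N \<ge> 2"
    and per: "\<And>i. l (i + N) = l i" "\<And>i. r (i + N) = r i" "\<And>i. s (i + N) = s i"
      "\<And>i. \<alpha> (i + N) = \<alpha> i" "\<And>i. Im (\<beta> (i + N)) = Im (\<beta> i)"
    and alt: "\<And>i. s (Suc i) \<noteq> s i"
    and agl: "\<And>i. G (Suc i) (l i) = G i (l i)" and agr: "\<And>i. G (Suc i) (r i) = G i (r i)"
    and hl: "\<And>i. Im (G i (l i)) > 0" and hr: "\<And>i. Im (G i (r i)) < 0"
    and side: "\<And>i. (if s i then (r i, l i) else (l i, r i)) \<in> cyclic_sides A B C D"
  shows "billiard_quad A B C D"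
proof -
  \<comment> \<open>The parameter at which the unfolded side meets the real axis; \<open>p i\<close>
    is this crossing pulled back to the quadrilateral.\<close>
  define t where "t i = Im (G i (l i)) / (Im (G i (l i)) - Im (G i (r i)))" for i
  define p where "p i = (1 - t i) *\<^sub>R l i + t i *\<^sub>R r i" for i
  define \<sigma> where "\<sigma> i = (if s i then (r i, l i) else (l i, r i))" for i
  have t01: "0 < t i" "t i < 1" for i
    using hl[of i] hr[of i] by (auto simp: t_def field_simps)
  have G_affine: "G i ((1 - u) *\<^sub>R x + u *\<^sub>R y) = (1 - u) *\<^sub>R G i x + u *\<^sub>R G i y" for i u x y
    by (simp only: G_def flip_simps) (simp add: algebra_simps)
  have G_diff: "G i x - G i y = \<alpha> i * flip (s i) (x - y)" for i x y
    by (simp add: G_def algebra_simps)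
  have Gp_Suc: "G (Suc i) (p i) = G i (p i)" for i
    unfolding p_def G_affine agl agr ..
  have Im_Gp: "Im (G i (p i)) = 0" for i
  proof -
    have "Im (G i (l i)) - Im (G i (r i)) \<noteq> 0" using hl[of i] hr[of i] by linarith
    then show ?thesis unfolding p_def G_affine
      by (simp add: t_def divide_simps)
  qed
  have lr: "l i \<noteq> r i" for i using hl[of i] hr[of i] by auto
  have p_seg: "p i \<in> open_segment (l i) (r i)" for i
    using t01 lr by (auto simp: in_segment p_def)
  have p_seg': "p i \<in> open_segment (fst (\<sigma> i)) (snd (\<sigma> i))" for i
    using p_seg[of i] by (auto simp: \<sigma>_def open_segment_commute)
  have \<sigma>_side: "\<sigma> i \<in> cyclic_sides A B C D" for i
    using side by (simp add: \<sigma>_def)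
  \<comment> \<open>Consecutive copies have opposite orientations, so a repeated side would have the
    same vertex above the axis at one crossing and below it at the next.\<close>
  have ne: "\<sigma> i \<noteq> \<sigma> (Suc i)" for i
  proof
    assume "\<sigma> i = \<sigma> (Suc i)"
    then have "l i = r (Suc i)" using alt[of i] by (auto simp: \<sigma>_def split: if_splits)
    then show False using hl[of i] hr[of "Suc i"] agl[of i] by auto
  qed
  text \<open>The side \<open>\<sigma> i\<close> is traversed downwards by the boundary of the copy \<open>G (Suc i)\<close>
    (oriented with that copy on its left), so the line enters this copy there.\<close>
  have step: "\<exists>d>0. \<alpha> (Suc i) * flip (s (Suc i)) (p (Suc i) - p i) = of_real d" for i
  proof -
    define d where "d = Re (G (Suc i) (p (Suc i))) - Re (G (Suc i) (p i))"
    have eq: "G (Suc i) (p (Suc i)) - G (Suc i) (p i) = of_real d"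
      using Im_Gp[of i] Im_Gp[of "Suc i"] Gp_Suc[of i] by (simp add: complex_eq_iff d_def)
    have a0: "\<alpha> (Suc i) \<noteq> 0"
      using hl[of "Suc i"] hr[of "Suc i"] by (auto simp: G_def)
    have "cross (snd (\<sigma> i) - fst (\<sigma> i)) (p (Suc i) - fst (\<sigma> i)) > 0"
      using cross_open_side[OF q, of "fst (\<sigma> i)" "snd (\<sigma> i)" "fst (\<sigma> (Suc i))" "snd (\<sigma> (Suc i))"]
        \<sigma>_side ne[of i] p_seg' by auto
    moreover have "cross (snd (\<sigma> i) - fst (\<sigma> i)) (p i - fst (\<sigma> i)) = 0"
      by (rule cross_own_side[OF p_seg'])
    moreover have "cross u (x - w) - cross u (y - w) = cross u (x - y)" for u x y w
      by (simp add: cross_alt algebra_simps)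
    ultimately have "cross (snd (\<sigma> i) - fst (\<sigma> i)) (p (Suc i) - p i) > 0"
      by (metis diff_zero)
    then have *: "cross (flip (s (Suc i)) (r i - l i)) (flip (s (Suc i)) (p (Suc i) - p i)) > 0"
      using alt[of i] by (cases "s i") (auto simp: \<sigma>_def flip_def cross_alt algebra_simps)
    have "cross (\<alpha> (Suc i) * x) (\<alpha> (Suc i) * y) = (cmod (\<alpha> (Suc i)))\<^sup>2 * cross x y" for x y
      unfolding cmod_power2 by (simp add: cross_alt power2_eq_square algebra_simps)
    then have "cross (G (Suc i) (r i) - G (Suc i) (l i)) (of_real d) > 0"
      unfolding eq[symmetric] G_diff using * a0 by simp
    then have "d * (Im (G i (l i)) - Im (G i (r i))) > 0"
      by (simp add: cross_alt agl agr algebra_simps)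
    then have "d > 0"
      using hl[of i] hr[of i] by (simp add: zero_less_mult_iff)
    then show ?thesis using eq G_diff by metis
  qed
  \<comment> \<open>In the unfolding every step points along the positive real axis, so its
    direction in the quadrilateral is the preimage of 1 under the linear part of the copy.\<close>
  have dir: "sgn (p (Suc i) - p i) = flip (s (Suc i)) (cnj (sgn (\<alpha> (Suc i))))" for i
  proof -
    obtain d where d: "d > 0" "\<alpha> (Suc i) * flip (s (Suc i)) (p (Suc i) - p i) = of_real d"
      using step by blast
    have a0: "\<alpha> (Suc i) \<noteq> 0" using d by auto
    have "sgn (\<alpha> (Suc i)) * sgn (flip (s (Suc i)) (p (Suc i) - p i)) = 1"
      using d by (metis sgn_mult sgn_of_real sgn_pos of_real_1)
    then have "sgn (flip (s (Suc i)) (p (Suc i) - p i)) = inverse (sgn (\<alpha> (Suc i)))"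
      by (metis inverse_unique mult.commute)
    also have "\<dots> = cnj (sgn (\<alpha> (Suc i)))"
      using a0 by (simp add: inverse_unit_complex norm_sgn)
    finally have "flip (s (Suc i)) (sgn (p (Suc i) - p i)) = cnj (sgn (\<alpha> (Suc i)))"
      by (simp only: sgn_flip)
    then show ?thesis by (metis flip_simps(4))
  qed
  have lq: "\<alpha> (Suc i) * flip (s (Suc i)) (r i - l i) = \<alpha> i * flip (s i) (r i - l i)" for i
    using G_diff[of "Suc i" "r i" "l i"] G_diff[of i "r i" "l i"] agl[of i] agr[of i] by simp
  \<comment> \<open>Two consecutive copies agree on their common side. Comparing the linear parts
    there introduces the squared direction of that side, which is the reflection law.\<close>
  have law: "sgn (p (Suc (Suc i)) - p (Suc i)) = reflect_dir (r (Suc i) - l (Suc i)) (sgn (p (Suc i) - p i))" for i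
  proof -
    let ?v = "sgn (r (Suc i) - l (Suc i))" and ?a = "sgn (\<alpha> (Suc i))" and ?b = "sgn (\<alpha> (Suc (Suc i)))"
    have v: "?v * cnj ?v = 1"
      using lr[of "Suc i"] by (metis complex_norm_square norm_sgn of_real_1 power_one right_minus_eq)
    have "sgn (\<alpha> (Suc (Suc i)) * flip (s (Suc (Suc i))) (r (Suc i) - l (Suc i))) =
        sgn (\<alpha> (Suc i) * flip (s (Suc i)) (r (Suc i) - l (Suc i)))"
      by (simp only: lq)
    then have e: "?b * flip (s (Suc (Suc i))) ?v = ?a * flip (s (Suc i)) ?v"
      by (simp only: sgn_mult sgn_flip)
    show ?thesis
    proof (cases "s (Suc i)")
      case True
      then have "\<not> s (Suc (Suc i))" using alt by blast
      then have "?b * (cnj ?v * ?v) = ?a * ?v * ?v"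
        using e True by (simp only: flip_def if_True if_False mult.assoc[symmetric])
      then have "?b = ?a * ?v\<^sup>2"
        using v by (simp add: mult.commute power2_eq_square mult.assoc)
      then show ?thesis
        using True \<open>\<not> s (Suc (Suc i))\<close> by (simp add: dir flip_def reflect_dir_def mult.commute)
    next
      case False
      then have *: "s (Suc (Suc i))" using alt by blast
      then have "cnj ?b * (cnj ?v * ?v) = cnj ?a * ?v * ?v"
        using arg_cong[OF e, of cnj] False
        by (simp only: flip_def if_True if_False mult.assoc[symmetric] complex_cnj_mult complex_cnj_cnj)
      then have "cnj ?b = cnj ?a * ?v\<^sup>2"
        using v by (simp add: mult.commute power2_eq_square mult.assoc)
      then show ?thesis
        using False * by (simp add: dir flip_def reflect_dir_def mult.commute)
    qed
  qed
  have law': "sgn (p (Suc (Suc i)) - p (Suc i)) =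
      reflect_dir (snd (\<sigma> (Suc i)) - fst (\<sigma> (Suc i))) (sgn (p (Suc i) - p i))" for i
    using law[of i] reflect_dir_minus[of "r (Suc i) - l (Suc i)"] by (auto simp: \<sigma>_def)
  have "periodic_billiard_path (inner_quad A B C D) (cyclic_sides A B C D) p N"
    unfolding periodic_billiard_path_def interior_inner_quad
  proof (intro conjI allI)
    show "2 \<le> N" by (rule N)
    show "p (i + N) = p i" for i
      by (simp add: p_def t_def G_def per)
    fix i
    have "p i \<noteq> p (i + 1)" using step[of i] by auto
    moreover have "open_segment (p i) (p (i + 1)) \<subseteq> inner_quad A B C D"
      using open_segment_inner_quad[OF q, of "fst (\<sigma> i)" "snd (\<sigma> i)" "fst (\<sigma> (Suc i))" "snd (\<sigma> (Suc i))"]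
        \<sigma>_side ne[of i] p_seg' by auto
    ultimately show "\<exists>(x, y)\<in>cyclic_sides A B C D. p (i + 1) \<in> open_segment x y \<and> p i \<noteq> p (i + 1) \<and>
        open_segment (p i) (p (i + 1)) \<subseteq> inner_quad A B C D \<and>
        sgn (p (i + 2) - p (i + 1)) = reflect_dir (y - x) (sgn (p (i + 1) - p i))"
      using \<sigma>_side[of "Suc i"] p_seg'[of "Suc i"] law'[of i]
      by (intro bexI[of _ "\<sigma> (Suc i)"]) (auto simp: case_prod_beta)
  qed
  then show ?thesis unfolding billiard_quad_def by blast
qed

section \<open>Paths close to a side or a diagonal\<close>

text \<open>\<open>y / cnj y * cnj x\<close> is the mirror image of \<open>x\<close> in the line
  spanned by \<open>y\<close>. Modulo pi the angle from \<open>x\<close> to \<open>y\<close> is pi/2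
  + \<theta>, so the reflection turns \<open>x\<close> by pi + 2 \<theta>; exchanging the roles
  changes the sign of \<theta>.\<close>

lemma reflect_across:
  fixes x y :: complex and \<rho> \<theta> :: real
  assumes y: "y = \<rho> *\<^sub>R (\<i> * cis \<theta> * x)" and "y \<noteq> 0"
  shows "y / cnj y * cnj x = - cis (2 * \<theta>) * x" and "x / cnj x * cnj y = - cis (- 2 * \<theta>) * y"
proof -
  have nz: "\<rho> \<noteq> 0" "x \<noteq> 0" using assms by auto
  have c: "cis (2 * \<theta>) = cis \<theta> * cis \<theta>" "cis (- 2 * \<theta>) = cis (- \<theta>) * cis (- \<theta>)"
    by (simp_all add: cis_mult)
  have i: "cis \<theta> * cis (- \<theta>) = 1" by (simp add: cis_mult)
  have cy: "cnj y = - (\<rho> *\<^sub>R (\<i> * cis (- \<theta>) * cnj x))"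
    by (simp add: y cis_cnj)
  have cn: "cis (- \<theta>) = inverse (cis \<theta>)" by (simp add: cis_inverse)
  show "y / cnj y * cnj x = - cis (2 * \<theta>) * x"
    unfolding cy c(1) using nz by (simp add: y scaleR_conv_of_real cn field_simps)
  show "x / cnj x * cnj y = - cis (- 2 * \<theta>) * y"
    unfolding cy c(2) using nz i by (simp add: y scaleR_conv_of_real cn field_simps)
qed

text \<open>The line unfolds the slit, of length 1, to a chain of segments with vertices \<open>P k\<close> and
directions \<open>\<phi> k\<close>. Odd vertices are copies of the slit end with interior angle \<open>pi/2 - a\<close>, even
ones of the end with interior angle \<open>pi/2 + c\<close>. The real axis is the path: it passes \<open>P k\<close> at
signed distance \<open>H k\<close>, below it iff \<open>\<sigma> k\<close>, and crosses the slit between \<open>P k\<close> and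
\<open>P (Suc k)\<close> iff \<open>\<sigma> k \<noteq> \<sigma> (Suc k)\<close>.\<close>

locale slit_word =
  fixes a c :: real and \<sigma> :: "nat \<Rightarrow> bool" and \<phi> H :: "nat \<Rightarrow> real" and K :: nat
  assumes K: "even K" "K > 0"
    and per: "\<And>k. \<sigma> (k + K) = \<sigma> k" "\<And>k. \<phi> (k + K) = \<phi> k" "\<And>k. H (k + K) = H k"
    and turn: "\<And>k. \<phi> (Suc k) =
      \<phi> k + (if \<sigma> (Suc k) then - 1 else 1) * (if odd (Suc k) then 2 * a else - 2 * c)"
    and H_Suc: "\<And>k. H (Suc k) = H k + sin (\<phi> k)"
    and H_sign: "\<And>k. if \<sigma> k then H k > 0 else H k < 0"
begin

text \<open>Only the heights are periodic. The sum of cosines accumulates the horizontal translation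
  over each period.\<close>

definition P :: "nat \<Rightarrow> complex" where
  "P k = Complex (\<Sum>j<k. cos (\<phi> j)) (H k)"

lemma Im_P [simp]: "Im (P k) = H k"
  by (simp add: P_def)

lemma P_Suc: "P (Suc k) = P k + cis (\<phi> k)"
  by (simp add: P_def H_Suc complex_eq_iff)

lemma H_pos [simp]: "\<sigma> k \<Longrightarrow> H k > 0" and H_neg [simp]: "\<not> \<sigma> k \<Longrightarrow> H k < 0"
  using H_sign[of k] by auto

text \<open>Here the slit is the side from 0 to 1. The sides attached to its ends have vertical
  extent at least \<open>B\<close> in the unfolding, more than any height \<open>H k\<close>, so
  their far ends lie across the path from the slit end \<open>P k\<close> that they are attached
  to.\<close>

lemma billiard_adjacent:
  fixes v2 v3 :: complex and r1 r3 B :: real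
  assumes v2: "v2 = 1 + r1 *\<^sub>R (\<i> * cis a)" and v3: "v3 = r3 *\<^sub>R (\<i> * cis c)"
    and q: "convex_quad 0 1 v2 v3"
    and HB: "\<And>k. \<bar>H k\<bar> < B"
    and far: "\<And>k. r1 * cos (\<phi> k + a) \<ge> B" "\<And>k. r1 * cos (\<phi> k - a) \<ge> B"
      "\<And>k. r3 * cos (\<phi> k + c) \<ge> B" "\<And>k. r3 * cos (\<phi> k - c) \<ge> B"
  shows "billiard_quad 0 1 v2 v3"
proof -
  text \<open>The crossing \<open>(k, True)\<close> is that of the slit between \<open>P k\<close> and \<open>P (Suc k)\<close>, and
    \<open>(k, False)\<close> that of the other side ending at \<open>P (Suc k)\<close>.\<close>
  define nxt where "nxt e = (if snd e then (fst e, False)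
     else (Suc (fst e), \<sigma> (Suc (fst e)) \<noteq> \<sigma> (Suc (Suc (fst e)))))" for e :: "nat \<times> bool"
  define start where "start k = (k, \<sigma> k \<noteq> \<sigma> (Suc k))" for k
  define ev where "ev i = (nxt ^^ i) (start 0)" for i
  \<comment> \<open>For the crossing \<open>e\<close>, \<open>x e\<close> below is a slit end on the
    crossed side, and \<open>u e\<close> records whether it lies above the path.\<close>
  define u where "u e = (if snd e then \<sigma> (fst e) else \<sigma> (Suc (fst e)))" for e :: "nat \<times> bool"
  define s where "s e = (even (fst e) \<longleftrightarrow> \<not> u e)" for e
  define \<alpha> where "\<alpha> e = (if even (fst e) then cis (\<phi> (fst e)) else - cis (\<phi> (fst e)))" for e :: "nat \<times> bool"
  define \<beta> where "\<beta> e = (if even (fst e) then P (fst e) else P (Suc (fst e)))" for e :: "nat \<times> bool"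
  define near where "near k = (if odd k then 1 else 0 :: complex)" for k :: nat
  define far where "far k = (if odd k then v2 else v3)" for k :: nat
  define x where "x e = (if snd e then near (fst e) else near (Suc (fst e)))" for e :: "nat \<times> bool"
  define y where "y e = (if snd e then near (Suc (fst e)) else far (Suc (fst e)))" for e :: "nat \<times> bool"
  define l where "l e = (if u e then x e else y e)" for e
  define r where "r e = (if u e then y e else x e)" for e
  have ev_Suc: "ev (Suc i) = nxt (ev i)" for i
    by (simp add: ev_def)
  \<comment> \<open>Each \<open>k\<close> accounts for one or two crossings, according to whether
    the slit is crossed, so the period in crossings is found by running from \<open>start 0\<close>
    until \<open>start K\<close>.\<close>
  have reach: "\<exists>i\<ge>k. ev i = start k" for k
  proof (induction k)
    case 0 show ?case by (intro exI[of _ 0]) (simp add: ev_def)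
  next
    case (Suc k)
    then obtain i where i: "i \<ge> k" "ev i = start k" by blast
    show ?case
    proof (cases "\<sigma> k = \<sigma> (Suc k)")
      case True
      then show ?thesis using i by (intro exI[of _ "Suc i"]) (simp add: ev_Suc nxt_def start_def)
    next
      case False
      then show ?thesis using i by (intro exI[of _ "Suc (Suc i)"]) (simp add: ev_Suc nxt_def start_def)
    qed
  qed
  then obtain N where N: "N \<ge> K" "ev N = start K" by blast
  define shift where "shift e = (fst e + K, snd e)" for e :: "nat \<times> bool"
  have per': "\<sigma> (Suc (k + K)) = \<sigma> (Suc k)" "\<sigma> (Suc (Suc (k + K))) = \<sigma> (Suc (Suc k))" 
    "\<phi> (Suc (k + K)) = \<phi> (Suc k)" "H (Suc (k + K)) = H (Suc k)" for k
    using per[of "Suc k"] per[of "Suc (Suc k)"] by auto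
  have start_shift: "start K = shift (start 0)"
    using per[of 0] per'[of 0] by (simp add: start_def shift_def)
  have nxt_shift: "nxt (shift e) = shift (nxt e)" for e
    by (simp add: nxt_def shift_def per')
  have ev_shift: "ev (i + N) = shift (ev i)" for i
    by (induction i) (simp_all add: N start_shift ev_Suc nxt_shift, simp add: ev_def)
  have valid: "snd (ev i) \<Longrightarrow> \<sigma> (fst (ev i)) \<noteq> \<sigma> (Suc (fst (ev i)))" for i
    by (induction i) (auto simp: ev_Suc nxt_def start_def ev_def)
  have u_shift: "u (shift e) = u e" for e
    by (simp add: u_def shift_def per per')
  have K2: "K \<ge> 2" using K by presburger
  define G where "G e z = \<beta> e + \<alpha> e * flip (s e) z" for e z
  have G_near: "G (k, b) (near k) = P k" "G (k, b) (near (Suc k)) = P (Suc k)" for k b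
    by (auto simp: G_def \<beta>_def \<alpha>_def near_def flip_def P_Suc)
  have G_far_Suc: "G (k, b) (far (Suc k)) = P (Suc k) + (if u (k, b) then - 1 else 1) *
     (if even k then r1 *\<^sub>R (\<i> * cis (if u (k, b) then \<phi> k - a else \<phi> k + a))
      else r3 *\<^sub>R (\<i> * cis (if u (k, b) then \<phi> k + c else \<phi> k - c)))" for k b
    by (auto simp: G_def \<beta>_def \<alpha>_def far_def flip_def P_Suc s_def v2 v3 scaleR_conv_of_real
        cis_cnj algebra_simps cis_mult)
  have G_far: "G (k, b) (far k) = P k + (if u (k, b) then - 1 else 1) *
     (if odd k then r1 *\<^sub>R (\<i> * cis (if u (k, b) then \<phi> k + a else \<phi> k - a))
      else r3 *\<^sub>R (\<i> * cis (if u (k, b) then \<phi> k - c else \<phi> k + c)))" for k b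
    by (auto simp: G_def \<beta>_def \<alpha>_def far_def flip_def P_Suc s_def v2 v3 scaleR_conv_of_real
        cis_cnj algebra_simps cis_mult)
  \<comment> \<open>Crossing the slit fixes both of its unfolded ends. Crossing the other side at
    \<open>P (Suc k)\<close> fixes its far end because \<open>turn\<close> makes
    \<open>G_far_Suc\<close> and \<open>G_far\<close> coincide.\<close>
  have agree: "G (ev (Suc i)) (x (ev i)) = G (ev i) (x (ev i)) \<and>
      G (ev (Suc i)) (y (ev i)) = G (ev i) (y (ev i))" for i
  proof -
    obtain k b where kb: "ev i = (k, b)" by (metis surj_pair)
    show ?thesis
    proof (cases b)
      case True
      then show ?thesis by (simp add: ev_Suc kb nxt_def x_def y_def G_near)
    next
      case False
      define b' where "b' \<longleftrightarrow> \<sigma> (Suc k) \<noteq> \<sigma> (Suc (Suc k))"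
      have "ev (Suc i) = (Suc k, b')" using False by (simp add: ev_Suc kb nxt_def b'_def)
      moreover have "u (Suc k, b') = \<sigma> (Suc k)" by (auto simp: u_def b'_def)
      moreover have "u (k, b) = \<sigma> (Suc k)" using False by (simp add: u_def)
      ultimately show ?thesis
        using False by (auto simp: kb x_def y_def G_near G_far G_far_Suc turn add.commute)
    qed
  qed
  have height: "if u (ev i) then Im (G (ev i) (x (ev i))) > 0 \<and> Im (G (ev i) (y (ev i))) < 0
      else Im (G (ev i) (x (ev i))) < 0 \<and> Im (G (ev i) (y (ev i))) > 0" for i
  proof -
    obtain k b where kb: "ev i = (k, b)" by (metis surj_pair)
    have vb: "b \<Longrightarrow> \<sigma> k \<noteq> \<sigma> (Suc k)" using valid[of i] kb by simp
    have "\<bar>H (Suc k)\<bar> < B" by (rule HB)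
    then show ?thesis
      using vb far[of k] by (cases b) (auto simp: kb x_def y_def G_near G_far_Suc u_def)
  qed
  show ?thesis
  proof (rule periodic_path_of_unfolding[OF q, where N = N and l = "\<lambda>i. l (ev i)" and r = "\<lambda>i. r (ev i)"
        and \<alpha> = "\<lambda>i. \<alpha> (ev i)" and \<beta> = "\<lambda>i. \<beta> (ev i)" and s = "\<lambda>i. s (ev i)"])
    show "N \<ge> 2" using N K2 by linarith
    fix i
    obtain k b where kb: "ev i = (k, b)" by (metis surj_pair)
    have vb: "b \<Longrightarrow> \<sigma> k \<noteq> \<sigma> (Suc k)" using valid[of i] kb by simp
    show "l (ev (i + N)) = l (ev i)" "r (ev (i + N)) = r (ev i)"
      using K by (simp_all add: ev_shift l_def r_def u_shift) 
        (simp_all add: shift_def x_def y_def near_def far_def)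
    show "s (ev (i + N)) = s (ev i)" "\<alpha> (ev (i + N)) = \<alpha> (ev i)"
      "Im (\<beta> (ev (i + N))) = Im (\<beta> (ev i))"
      using K by (simp_all add: ev_shift s_def u_shift \<alpha>_def \<beta>_def) 
        (simp_all add: shift_def per per')
    show "s (ev (Suc i)) \<noteq> s (ev i)"
      using vb by (auto simp: ev_Suc kb nxt_def s_def u_def)
    show "\<beta> (ev (Suc i)) + \<alpha> (ev (Suc i)) * flip (s (ev (Suc i))) (l (ev i)) =
        \<beta> (ev i) + \<alpha> (ev i) * flip (s (ev i)) (l (ev i))"
      "\<beta> (ev (Suc i)) + \<alpha> (ev (Suc i)) * flip (s (ev (Suc i))) (r (ev i)) =
        \<beta> (ev i) + \<alpha> (ev i) * flip (s (ev i)) (r (ev i))"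
      using agree[of i] by (simp_all add: G_def[symmetric] l_def r_def)
    show "Im (\<beta> (ev i) + \<alpha> (ev i) * flip (s (ev i)) (l (ev i))) > 0"
      "Im (\<beta> (ev i) + \<alpha> (ev i) * flip (s (ev i)) (r (ev i))) < 0"
      using height[of i] by (simp_all add: G_def[symmetric] l_def r_def split: if_splits)
    show "(if s (ev i) then (r (ev i), l (ev i)) else (l (ev i), r (ev i))) \<in> cyclic_sides 0 1 v2 v3"
      using vb by (cases b; cases "even k"; cases "\<sigma> (Suc k)") (auto simp: kb s_def l_def r_def u_def x_def y_def near_def far_def cyclic_sides_def)
  qed
qed

text \<open>Here the slit is the diagonal from 0 to 1, with \<open>vb\<close> below and
  \<open>vt\<close> above. Crossing it is no bounce, so every vertex \<open>P (Suc k)\<close>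
  contributes exactly the two sides that meet there. The bounds \<open>top\<close> and
  \<open>bot\<close> keep \<open>vt\<close> and \<open>vb\<close> across the path in every tilted
  copy.\<close>

lemma billiard_diagonal:
  fixes vb vt :: complex and \<rho> \<rho>' B :: real
  assumes vt: "vt = \<rho> *\<^sub>R (\<i> * cis c * vb)" and vb: "vb - 1 = \<rho>' *\<^sub>R (\<i> * cis (- a) * (vt - 1))"
    and q: "convex_quad 0 vb 1 vt"
    and HB: "\<And>k. \<bar>H k\<bar> < B"
    and top: "\<And>k. Im (cis (\<phi> k) * vt) \<ge> B" "\<And>k. Im (cis (\<phi> k) * (vt - 1)) \<ge> B"
    and bot: "\<And>k. Im (cis (\<phi> k) * vb) \<le> - B" "\<And>k. Im (cis (\<phi> k) * (vb - 1)) \<le> - B"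
  shows "billiard_quad 0 vb 1 vt"
proof -
  text \<open>To get round \<open>P (Suc k)\<close> the line leaves the copy containing slit segment \<open>k\<close> through the
    side to \<open>f1 k\<close>, crosses a corner of a reflected copy and enters the next copy through the
    side to \<open>f2 k\<close>; these are the crossings \<open>2 * k\<close> and \<open>2 * k + 1\<close>.\<close>
  define near where "near k = (if odd k then 1 else 0 :: complex)" for k :: nat
  define f1 where "f1 k = (if even k = \<sigma> (Suc k) then vb else vt)" for k
  define f2 where "f2 k = (if even k = \<sigma> (Suc k) then vt else vb)" for k
  define e where "e k = (if even k then cis (\<phi> k) else - cis (\<phi> k))" for k :: nat
  define w where "w k = (f1 k - near (Suc k)) / cnj (f1 k - near (Suc k))" for k
  define \<alpha> where "\<alpha> i = (if even i then e (i div 2) else e (i div 2) * w (i div 2))" for i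
  define \<beta> where "\<beta> i = P (Suc (i div 2)) - \<alpha> i * near (Suc (i div 2))" for i
  define y where "y i = (if even i then f1 (i div 2) else f2 (i div 2))" for i
  define l where "l i = (if \<sigma> (Suc (i div 2)) then near (Suc (i div 2)) else y i)" for i
  define r where "r i = (if \<sigma> (Suc (i div 2)) then y i else near (Suc (i div 2)))" for i
  define G where "G i z = \<beta> i + \<alpha> i * flip (even i) z" for i z
  have d: "distinct [0, vb, 1, vt]" by (rule convex_quad_distinct[OF q])
  have eSuc: "e (Suc k) = - e k * cis (\<phi> (Suc k) - \<phi> k)" for k
    by (simp add: e_def cis_mult)
  have G_eq: "G i z = P (Suc (i div 2)) + \<alpha> i * flip (even i) (z - near (Suc (i div 2)))" for i z
    by (simp add: G_def \<beta>_def near_def flip_def algebra_simps)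
  have G_near: "G i (near (Suc (i div 2))) = P (Suc (i div 2))" for i
    by (simp add: G_eq flip_def)
  have front: "G (2 * k) z = P k + e k * (z - near k)" for k z
    by (auto simp: G_eq flip_def \<alpha>_def near_def P_Suc e_def algebra_simps)
  have front': "G (2 * k) z = P (Suc k) + e k * (z - near (Suc k))" for k z
    by (auto simp: G_eq flip_def \<alpha>_def)
  have corner: "G (Suc (2 * k)) z = P (Suc k) + e k * w k * cnj (z - near (Suc k))" for k z
    by (simp add: G_eq flip_def \<alpha>_def)
  have ag1: "G (Suc (2 * k)) (f1 k) = G (2 * k) (f1 k)" for k
    using d by (auto simp: corner front' w_def f1_def near_def)
  \<comment> \<open>Two reflections in sides through \<open>P (Suc k)\<close> compose to a rotation
    by twice the interior angle; by \<open>turn\<close> this is pi plus the change of direction of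
    the slit, and the alternating sign in \<open>e\<close> absorbs the pi.\<close>
  have ag2: "G (2 * Suc k) (f2 k) = G (Suc (2 * k)) (f2 k)" for k
  proof -
    have "w k * cnj (f2 k - near (Suc k)) = - cis (\<phi> (Suc k) - \<phi> k) * (f2 k - near (Suc k))"
    proof (cases "even k")
      case True
      have nz: "vb - 1 \<noteq> 0" using d by auto
      show ?thesis
        using reflect_across[OF vb nz] True
        by (auto simp: w_def f1_def f2_def near_def turn)
    next
      case False
      have nz: "vt \<noteq> 0" using d by auto
      show ?thesis
        using reflect_across[OF vt nz] False
        by (auto simp: w_def f1_def f2_def near_def turn)
    qed
    then show ?thesis
      using front[of "Suc k" "f2 k"] by (simp add: corner eSuc mult.assoc)
  qed
  have agn: "G (Suc i) (near (Suc (i div 2))) = G i (near (Suc (i div 2)))" for i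
  proof (cases "even i")
    case True then show ?thesis using G_near[of i] by (auto elim!: evenE simp: corner front')
  next
    case False 
    then obtain k where "i = Suc (2 * k)" by (metis oddE Suc_eq_plus1)
    then show ?thesis using front[of "Suc k"] by (simp add: corner)
  qed
  have agy: "G (Suc i) (y i) = G i (y i)" for i
  proof (cases "even i")
    case True then show ?thesis by (auto elim!: evenE simp: y_def ag1)
  next
    case False 
    then obtain k where "i = Suc (2 * k)" by (metis oddE Suc_eq_plus1)
    then show ?thesis using ag2[of k] by (simp add: y_def)
  qed
  have hy: "if \<sigma> (Suc (i div 2)) then Im (G i (y i)) < 0 else Im (G i (y i)) > 0" for i
  proof (cases "even i")
    case True
    then obtain k where k: "i = 2 * k" by (elim evenE)
    show ?thesis using top[of k] bot[of k] HB[of "Suc k"]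
      by (auto simp: k y_def front' f1_def e_def near_def)
  next
    case False
    then obtain k where k: "i = Suc (2 * k)" by (metis oddE Suc_eq_plus1)
    have "G i (y i) = G (2 * Suc k) (f2 k)" using ag2[of k] by (simp add: k y_def)
    then have "G i (y i) = P (Suc k) + e (Suc k) * (f2 k - near (Suc k))"
      by (simp only: front)
    then show ?thesis using top[of "Suc k"] bot[of "Suc k"] HB[of "Suc k"]
      by (auto simp: k f2_def e_def near_def)
  qed
  have "\<sigma> (Suc (k + K)) = \<sigma> (Suc k)" "H (Suc (k + K)) = H (Suc k)" for k
    using per[of "Suc k"] by auto
  note per' = this this[unfolded add.commute[of _ K]]
  have "near (k + K) = near k" "near (Suc (k + K)) = near (Suc k)"
      "f1 (k + K) = f1 k" "f2 (k + K) = f2 k" "e (k + K) = e k" "w (k + K) = w k" for k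
    using K per per' by (simp_all add: near_def f1_def f2_def e_def w_def)
  note perK = this this[unfolded add.commute[of _ K]]
  show ?thesis
  proof (rule periodic_path_of_unfolding[OF q, where N = "2 * K" and l = l and r = r
        and \<alpha> = \<alpha> and \<beta> = \<beta> and s = even])
    show "2 * K \<ge> 2" using K by simp
    fix i
    show "l (i + 2 * K) = l i" "r (i + 2 * K) = r i"
      by (simp_all add: l_def r_def y_def perK per')
    show "even (i + 2 * K) = even i" "even (Suc i) \<noteq> even i" by simp_all
    show \<alpha>: "\<alpha> (i + 2 * K) = \<alpha> i"
      by (simp add: \<alpha>_def perK)
    show "Im (\<beta> (i + 2 * K)) = Im (\<beta> i)"
      by (simp add: \<beta>_def \<alpha> perK per')
    show "\<beta> (Suc i) + \<alpha> (Suc i) * flip (even (Suc i)) (l i) = \<beta> i + \<alpha> i * flip (even i) (l i)"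
      "\<beta> (Suc i) + \<alpha> (Suc i) * flip (even (Suc i)) (r i) = \<beta> i + \<alpha> i * flip (even i) (r i)"
      using agn[of i] agy[of i] by (simp_all only: G_def[symmetric] l_def r_def split: if_split) auto
    show "Im (\<beta> i + \<alpha> i * flip (even i) (l i)) > 0" "Im (\<beta> i + \<alpha> i * flip (even i) (r i)) < 0"
      using hy[of i] G_near[of i] by (simp_all only: G_def[symmetric] l_def r_def split: if_split) auto
    show "(if even i then (r i, l i) else (l i, r i)) \<in> cyclic_sides 0 vb 1 vt"
      by (auto simp: l_def r_def y_def f1_def f2_def near_def cyclic_sides_def)
  qed
qed

end

section \<open>The four combinatorial types\<close>

text \<open>Words are listed as triples \<open>(\<sigma> k, \<phi> k, H k)\<close>. In each of them \<open>\<phi>\<close> is shifted so that the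
sines of the directions cancel over a period, which makes the holonomy a horizontal translation;
the level \<open>b\<close> of the line is any value separating the two kinds of vertices.\<close>

definition word_step ::
  "real \<Rightarrow> real \<Rightarrow> bool \<Rightarrow> bool \<times> real \<times> real \<Rightarrow> bool \<times> real \<times> real \<Rightarrow> bool" where
  "word_step a c b x y = (case x of (s, f, h) \<Rightarrow> case y of (s', f', h') \<Rightarrow>
     f' = f + (if s' then - 1 else 1) * (if b then 2 * a else - 2 * c) \<and> h' = h + sin f \<and>
     (if s' then h' > 0 else h' < 0))"

fun word_chain :: "real \<Rightarrow> real \<Rightarrow> bool \<Rightarrow> (bool \<times> real \<times> real) list \<Rightarrow> bool" where
  "word_chain a c b (x # y # zs) = (word_step a c b x y \<and> word_chain a c (\<not> b) (y # zs))"
| "word_chain a c b [x] = True"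
| "word_chain a c b [] = True"

lemma word_chain_nth:
  "word_chain a c b xs \<Longrightarrow> Suc k < length xs \<Longrightarrow>
    word_step a c (if even k then b else \<not> b) (xs ! k) (xs ! Suc k)"
proof (induction k arbitrary: b xs)
  case 0
  then show ?case by (cases "(a, c, b, xs)" rule: word_chain.cases) auto
next
  case (Suc k)
  then show ?case
    by (cases "(a, c, b, xs)" rule: word_chain.cases) (auto dest!: Suc.IH)
qed

text \<open>Appending \<open>hd xs\<close> makes the chain test the closing step too. Even length
  keeps the parity of vertices under reduction modulo the length.\<close>

lemma slit_word_of_list:
  assumes xs: "even (length xs)" "xs \<noteq> []" and ch: "word_chain a c True (xs @ [hd xs])"
  defines "x \<equiv> \<lambda>k. xs ! (k mod length xs)"
  shows "slit_word a c (\<lambda>k. fst (x k)) (\<lambda>k. fst (snd (x k))) (\<lambda>k. snd (snd (x k))) (length xs)"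
proof -
  let ?K = "length xs"
  have K: "?K > 0" using xs by simp
  have st: "word_step a c (odd (Suc k)) (x k) (x (Suc k))" for k
  proof -
    let ?j = "k mod ?K"
    have j: "?j < ?K" using K by simp
    have "even ?j = even k" using xs by (simp add: dvd_mod_iff)
    moreover have "(xs @ [hd xs]) ! ?j = x k" using j by (simp add: nth_append x_def)
    moreover have "(xs @ [hd xs]) ! Suc ?j = x (Suc k)"
      using j xs Suc_leI[OF j] by (cases "Suc ?j = ?K") (auto simp: nth_append x_def mod_Suc hd_conv_nth)
    ultimately show ?thesis
      using word_chain_nth[OF ch, of ?j] j by (auto split: if_splits)
  qed
  have "x (k + ?K) = x k" for k by (simp add: x_def)
  \<comment> \<open>A step tests the sign only at its target, so the sign at \<open>k\<close> is
    read off the step that arrives there one period later.\<close>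
  moreover have "if fst (x k) then snd (snd (x k)) > 0 else snd (snd (x k)) < 0" for k
  proof -
    have "Suc (k + (?K - 1)) = k + ?K" using K by simp
    then have "x (Suc (k + (?K - 1))) = x k" by (simp only: x_def mod_add_self2)
    then have "\<exists>b y. word_step a c b y (x k)"
      using st[of "k + (?K - 1)"] by metis
    then show ?thesis
      by (auto simp: word_step_def case_prod_beta split: if_splits)
  qed
  ultimately show ?thesis
    using st xs by unfold_locales (auto simp: word_step_def case_prod_beta)
qed

text \<open>The constants 7 and 100 are generous and serve all four types; what matters is that
  directions and heights are of order \<epsilon>.\<close>

definition word_within :: "real \<Rightarrow> real \<Rightarrow> real \<Rightarrow> bool" where
  "word_within a c \<epsilon> \<longleftrightarrow> (\<exists>\<sigma> \<phi> H K. slit_word a c \<sigma> \<phi> H K \<and>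
     (\<forall>k. \<bar>\<phi> k\<bar> \<le> 7 * \<epsilon>) \<and> (\<forall>k. \<bar>H k\<bar> < 100 * \<epsilon>))"

lemma word_within_of_list:
  assumes xs: "even (length xs)" "xs \<noteq> []" and ch: "word_chain a c True (xs @ [hd xs])"
    and b: "\<forall>x\<in>set xs. \<bar>fst (snd x)\<bar> \<le> 7 * \<epsilon> \<and> \<bar>snd (snd x)\<bar> < 100 * \<epsilon>"
  shows "word_within a c \<epsilon>"
proof -
  have "xs ! (k mod length xs) \<in> set xs" for k using xs by simp
  then show ?thesis
    unfolding word_within_def using slit_word_of_list[OF xs ch] b by blast
qed

text \<open>Odd and even vertices each lie once above and once below the path, so the turns cancel
  for all \<open>a\<close> and \<open>c\<close>. A separating level exists because
  \<open>c < 0\<close> makes \<open>q\<close> smaller than \<open>p\<close>, and sin p + sin q = 2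
  sin a cos c is positive.\<close>

lemma word_neg:
  assumes "a > 0" "c < 0" "\<bar>a\<bar> \<le> \<epsilon>" "\<bar>c\<bar> \<le> \<epsilon>" "\<epsilon> \<le> 1 / 10"
  shows "word_within a c \<epsilon>"
proof -
  define p q where "p = a - c" and "q = a + c"
  have pi: "pi / 2 > 1" using pi_gt3 by simp
  have p: "0 < sin p" using assms pi by (intro sin_gt_zero) (auto simp: p_def)
  have qp: "sin q < sin p" using assms pi by (intro sin_monotone_2pi) (auto simp: p_def q_def)
  have "sin p + sin q = 2 * sin a * cos c"
    by (simp add: p_def q_def sin_add sin_diff)
  moreover have "sin a > 0" "cos c > 0" using assms pi by (auto intro!: sin_gt_zero cos_gt_zero_pi)
  ultimately have pq: "sin p + sin q > 0" by simp
  have "max (- sin p - sin q) (- sin p) < min 0 (- sin q)" using p qp pq by auto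
  then obtain b where b: "max (- sin p - sin q) (- sin p) < b" "b < min 0 (- sin q)"
    using dense by blast
  have bd: "\<bar>sin p\<bar> \<le> 2 * \<epsilon>" "\<bar>sin q\<bar> \<le> 2 * \<epsilon>"
    using abs_sin_x_le_abs_x[of p] abs_sin_x_le_abs_x[of q] assms by (auto simp: p_def q_def)
  show ?thesis
    by (rule word_within_of_list[of "[(False, p, - sin p - b), (True, - q, - b), (True, - p, - sin q - b),
        (False, q, - sin q - sin p - b)]"])
      (use assms b bd in \<open>auto simp: word_step_def\<close>, auto simp: p_def q_def)
qed

text \<open>Only one odd vertex lies above the path. With a general \<open>c\<close> the turns would
  add up to -4 c, so this word closes only for c = 0.\<close>

lemma word_zero:
  assumes "a > 0" "\<bar>a\<bar> \<le> \<epsilon>" "\<epsilon> \<le> 1 / 10"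
  shows "word_within a 0 \<epsilon>"
proof -
  define b where "b = - sin a / 2"
  have a: "0 < sin a" using assms pi_gt3 by (intro sin_gt_zero) auto
  then have b: "b < 0" "- sin a < b" by (auto simp: b_def)
  have bd: "\<bar>sin a\<bar> \<le> \<epsilon>" using abs_sin_x_le_abs_x[of a] assms by auto
  show ?thesis
    by (rule word_within_of_list[of "[(False, a, - sin a - b), (True, - a, - b), (False, - a, - sin a - b),
        (False, a, - 2 * sin a - b)]"])
      (use assms b bd a in \<open>auto simp: word_step_def\<close>)
qed

text \<open>One odd vertex lies above the path and the other five vertices below. For general angles
  the turns would add up to 2 a - 6 c, so this word closes only for a = 3 c.\<close>

lemma word_third:
  assumes "c > 0" "\<bar>3 * c\<bar> \<le> \<epsilon>" "\<epsilon> \<le> 1 / 10"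
  shows "word_within (3 * c) c \<epsilon>"
proof -
  define p q where "p = 3 * c" and "q = 5 * c"
  define b where "b = - sin p / 2"
  have pi: "pi / 2 > 1" using pi_gt3 by simp
  have p: "0 < sin p" "0 < sin q" using assms pi by (auto intro!: sin_gt_zero simp: p_def q_def)
  then have b: "b < 0" "- sin p < b" by (auto simp: b_def)
  have qc: "sin c < sin q" using assms pi by (intro sin_monotone_2pi) (auto simp: q_def)
  have bd: "\<bar>sin p\<bar> \<le> 2 * \<epsilon>" "\<bar>sin q\<bar> \<le> 2 * \<epsilon>" "\<bar>sin c\<bar> \<le> \<epsilon>"
    using abs_sin_x_le_abs_x[of p] abs_sin_x_le_abs_x[of q] abs_sin_x_le_abs_x[of c] assms
    by (auto simp: p_def q_def)
  show ?thesis
    by (rule word_within_of_list[of "[(False, p, - sin p - b), (True, - p, - b), (False, - q, - sin p - b),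
        (False, c, - sin p - sin q - b), (False, - c, - sin p - sin q + sin c - b),
        (False, q, - sin p - sin q - b)]"])
      (use assms b bd p qc in \<open>auto simp: word_step_def\<close>, auto simp: p_def q_def)
qed

text \<open>Odd and even vertices each lie four times above and four times below the path, so the
  turns again cancel for all \<open>a\<close> and \<open>c\<close>; only the existence of a
  separating level restricts the angles.\<close>

lemma word_pos:
  assumes "0 < c" "3 * c < a" "\<bar>a\<bar> \<le> \<epsilon>" "\<epsilon> \<le> 1 / 10"
  shows "word_within a c \<epsilon>"
proof -
  define p q r t w where "p = a - 2 * c" and "q = a - 4 * c" and "r = 3 * a - 4 * c"
    and "t = 3 * a - 2 * c" and "w = a + 2 * c"
  have pi: "pi / 2 > 1" using pi_gt3 by simp
  have pos: "sin a > 0" "sin p > 0" "sin r > 0" "sin t > 0" "sin w > 0"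
    using assms pi by (auto intro!: sin_gt_zero simp: p_def r_def t_def w_def)
  have pw: "sin p < sin w" using assms pi by (intro sin_monotone_2pi) (auto simp: p_def w_def)
  have qa: "sin q < sin a" using assms pi by (intro sin_monotone_2pi) (auto simp: q_def)
  \<comment> \<open>This is the height of the vertex at \<open>h + sin r\<close> over the one at
    \<open>- sin a\<close>. The factor sin (a - 3 c) is where \<open>3 * c < a\<close> enters; it
    vanishes in the borderline case of \<open>word_third\<close>.\<close>
  have "sin r - sin w + (sin p + sin q) = 2 * sin (a - 3 * c) * (cos (2 * a - c) + cos c)"
  proof -
    have "r = (2 * a - c) + (a - 3 * c)" "w = (2 * a - c) - (a - 3 * c)"
      "p = (a - 3 * c) + c" "q = (a - 3 * c) - c"
      by (simp_all add: r_def w_def p_def q_def)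
    then show ?thesis by (simp only: sin_add sin_diff) (simp add: algebra_simps)
  qed
  moreover have "sin (a - 3 * c) > 0" "cos (2 * a - c) > 0" "cos c > 0"
    using assms pi by (auto intro!: sin_gt_zero cos_gt_zero_pi)
  ultimately have key: "sin r - sin w + (sin p + sin q) > 0"
    by (simp add: add_pos_pos)
  define h where "h = - sin a - sin w + sin p + sin q"
  \<comment> \<open>These four heights are the ones closest to the level; all other vertices lie
    weakly beyond them on their own side.\<close>
  have "max (- sin a) h < min 0 (h + sin r)" using pos pw qa key by (auto simp: h_def)
  then obtain b where b: "max (- sin a) h < b" "b < min 0 (h + sin r)"
    using dense by blast
  have bd: "\<bar>sin a\<bar> \<le> \<epsilon>" "\<bar>sin p\<bar> \<le> 3 * \<epsilon>" "\<bar>sin q\<bar> \<le> 3 * \<epsilon>" "\<bar>sin r\<bar> \<le> 3 * \<epsilon>" "\<bar>sin t\<bar> \<le> 3 * \<epsilon>" "\<bar>sin w\<bar> \<le> 3 * \<epsilon>"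
    using abs_sin_x_le_abs_x[of a] abs_sin_x_le_abs_x[of p] abs_sin_x_le_abs_x[of q] 
      abs_sin_x_le_abs_x[of r] abs_sin_x_le_abs_x[of t] abs_sin_x_le_abs_x[of w] assms
    by (auto simp: p_def q_def r_def t_def w_def)
  show ?thesis
    by (rule word_within_of_list[of "[(False, a, - sin a - b), (True, - a, - b),
        (False, - w, - sin a - b), (False, p, - sin a - sin w - b), (False, q, - sin a - sin w + sin p - b),
        (False, r, h - b), (True, t, h + sin r - b), (True, p, h + sin r + sin t - b),
        (True, a, h + sin r + sin t + sin p - b), (True, - a, h + sin r + sin t + sin p + sin a - b),
        (True, - p, h + sin r + sin t + sin p - b), (True, - t, h + sin r + sin t - b),
        (True, - r, h + sin r - b), (False, - q, h - b), (False, - p, - sin a - sin w + sin p - b),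
        (False, w, - sin a - sin w - b)]"])
      (use assms b bd pos pw qa in \<open>auto simp: word_step_def h_def\<close>, auto simp: p_def q_def r_def t_def w_def)
qed

lemma word_exists:
  assumes "a > 0" "3 * c \<le> a" "\<bar>a\<bar> \<le> \<epsilon>" "\<bar>c\<bar> \<le> \<epsilon>" "\<epsilon> \<le> 1 / 10"
  shows "word_within a c \<epsilon>"
proof -
  consider "c < 0" | "c = 0" | "c > 0" "a = 3 * c" | "0 < c" "3 * c < a"
    using assms(2) by linarith
  then show ?thesis
    by cases (use assms word_neg word_zero word_third[of c \<epsilon>] word_pos in auto)
qed

section \<open>Corners and similarities\<close>

text \<open>The counterclockwise angle at \<open>B\<close> from \<open>C\<close> to \<open>A\<close>
  is pi/2 + \<alpha>. The bounds on the ratio of the two sides keep the shape from degenerating,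
  uniformly in the small angle \<alpha>.\<close>

definition corner :: "real \<Rightarrow> complex \<Rightarrow> complex \<Rightarrow> complex \<Rightarrow> real \<Rightarrow> bool" where
  "corner \<eta> A B C \<alpha> \<longleftrightarrow> (\<exists>\<rho>. \<eta> \<le> \<rho> \<and> \<rho> \<le> 1 / \<eta> \<and> A - B = \<rho> *\<^sub>R (\<i> * cis \<alpha> * (C - B)))"

section \<open>Invariance under similarities\<close>

lemma cross_similar: "cross (m * u) (m * v) = (cmod m)\<^sup>2 * cross u v"
  unfolding cmod_power2 by (simp add: cross_alt power2_eq_square algebra_simps)

lemma corner_affine:
  assumes "m \<noteq> 0"
  shows "corner \<eta> (m * A + k) (m * B + k) (m * C + k) \<alpha> \<longleftrightarrow> corner \<eta> A B C \<alpha>"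
proof -
  have "(m * A + k) - (m * B + k) = \<rho> *\<^sub>R (\<i> * cis \<alpha> * ((m * C + k) - (m * B + k))) \<longleftrightarrow>
      A - B = \<rho> *\<^sub>R (\<i> * cis \<alpha> * (C - B))" for \<rho>
  proof -
    have "(m * A + k) - (m * B + k) = m * (A - B)"
      "\<rho> *\<^sub>R (\<i> * cis \<alpha> * ((m * C + k) - (m * B + k))) = m * (\<rho> *\<^sub>R (\<i> * cis \<alpha> * (C - B)))"
      by (simp_all add: scaleR_conv_of_real algebra_simps)
    then show ?thesis using assms by (simp only: mult_cancel_left simp_thms)
  qed
  then show ?thesis by (simp only: corner_def)
qed

text \<open>Conjugation keeps the size of the angle but reverses orientation, so the outer points
  change places and the ratio is inverted; its range from \<eta> to 1 / \<eta> is symmetric under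
  inversion.\<close>

lemma corner_cnj:
  assumes "corner \<eta> A B C \<alpha>" "\<eta> > 0"
  shows "corner \<eta> (cnj C) (cnj B) (cnj A) \<alpha>"
proof -
  obtain \<rho> where \<rho>: "\<eta> \<le> \<rho>" "\<rho> \<le> 1 / \<eta>" "A - B = \<rho> *\<^sub>R (\<i> * cis \<alpha> * (C - B))"
    using assms by (auto simp: corner_def)
  have "cnj (A - B) = - (\<rho> *\<^sub>R (\<i> * cis (- \<alpha>) * cnj (C - B)))"
    unfolding \<rho>(3) by (simp add: cis_cnj)
  moreover have "\<i> * x * z = \<rho> *\<^sub>R (x * y * w)" if "z = - (\<rho> *\<^sub>R (\<i> * y * w))" for x y z w
    unfolding that by (simp add: scaleR_conv_of_real algebra_simps)
  ultimately have "\<i> * cis \<alpha> * cnj (A - B) = \<rho> *\<^sub>R (cis \<alpha> * cis (- \<alpha>) * cnj (C - B))"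
    by blast
  then have "\<i> * cis \<alpha> * (cnj A - cnj B) = \<rho> *\<^sub>R (cnj C - cnj B)"
    by (simp only: cis_mult add.right_inverse cis_zero mult_1 complex_cnj_diff)
  then have "cnj C - cnj B = (1 / \<rho>) *\<^sub>R (\<i> * cis \<alpha> * (cnj A - cnj B))"
    using \<rho> assms(2) by simp
  moreover have "\<eta> \<le> 1 / \<rho>" "1 / \<rho> \<le> 1 / \<eta>"
    using \<rho> assms(2) by (auto simp: field_simps)
  ultimately show ?thesis unfolding corner_def by blast
qed

lemma convex_quad_affine:
  assumes "m \<noteq> 0"
  shows "convex_quad (m * A + k) (m * B + k) (m * C + k) (m * D + k) \<longleftrightarrow> convex_quad A B C D"
proof -
  have *: "(m * x + k) - (m * y + k) = m * (x - y)" for x y by (simp add: algebra_simps)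
  show ?thesis
    unfolding convex_quad_def * cross_similar using assms by (simp add: zero_less_mult_iff)
qed

lemma convex_quad_cnj: "convex_quad (cnj B) (cnj A) (cnj D) (cnj C) \<longleftrightarrow> convex_quad A B C D"
  by (auto simp: convex_quad_def cross_alt algebra_simps)

text \<open>Similarities of either orientation preserve the reflection law. A side may be mapped to
  its reversal because \<open>reflect_dir\<close> depends only on the line of the side.\<close>

lemma billiard_quad_map:
  fixes T :: "complex \<Rightarrow> complex"
  assumes T: "\<And>z. T z = m * flip s z + k" and m: "m \<noteq> 0"
    and inn: "\<And>z. z \<in> inner_quad A B C D \<Longrightarrow> T z \<in> inner_quad A' B' C' D'"
    and sides: "\<And>x y. (x, y) \<in> cyclic_sides A B C D \<Longrightarrow>
      (T x, T y) \<in> cyclic_sides A' B' C' D' \<or> (T y, T x) \<in> cyclic_sides A' B' C' D'"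
    and b: "billiard_quad A B C D"
  shows "billiard_quad A' B' C' D'"
proof -
  obtain p n where p: "periodic_billiard_path (inner_quad A B C D) (cyclic_sides A B C D) p n"
    using b by (auto simp: billiard_quad_def)
  have diff: "T x - T y = m * flip s (x - y)" for x y by (simp add: T algebra_simps)
  have sg: "sgn (T x - T y) = sgn m * flip s (sgn (x - y))" for x y
    by (simp only: diff sgn_mult sgn_flip)
  have m1: "sgn m * cnj (sgn m) = 1"
    using m by (metis complex_norm_square norm_sgn of_real_1 power_one)
  have refl: "reflect_dir (T y - T x) (sgn m * flip s d) = sgn m * flip s (reflect_dir (y - x) d)" for x y d
  proof -
    have "reflect_dir (T y - T x) (sgn m * flip s d) =
        (sgn m * cnj (sgn m)) * sgn m * ((flip s (sgn (y - x)))\<^sup>2 * cnj (flip s d))"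
      unfolding reflect_dir_def sg by (simp add: power2_eq_square)
    also have "\<dots> = sgn m * flip s (reflect_dir (y - x) d)"
      unfolding m1 by (simp add: reflect_dir_def flip_def power2_eq_square)
    finally show ?thesis .
  qed
  have inj: "T x = T y \<longleftrightarrow> x = y" for x y
    using diff[of x y] m by (cases s) (auto simp: flip_def)
  have seg: "open_segment (T x) (T y) = T ` open_segment x y" for x y
  proof -
    have "T ((1 - u) *\<^sub>R x + u *\<^sub>R y) = (1 - u) *\<^sub>R T x + u *\<^sub>R T y" for u
      by (simp only: T flip_simps) (simp add: algebra_simps)
    then show ?thesis unfolding open_segment_image_interval by (simp add: inj image_image)
  qed
  have "periodic_billiard_path (inner_quad A' B' C' D') (cyclic_sides A' B' C' D') (\<lambda>i. T (p i)) n"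
    unfolding periodic_billiard_path_def interior_inner_quad
  proof (intro conjI allI)
    show "2 \<le> n" "T (p (i + n)) = T (p i)" for i
      using p by (simp_all add: periodic_billiard_path_def)
    fix i
    obtain x y where xy: "(x, y) \<in> cyclic_sides A B C D" "p (i + 1) \<in> open_segment x y"
        "p i \<noteq> p (i + 1)" "open_segment (p i) (p (i + 1)) \<subseteq> inner_quad A B C D"
        "sgn (p (i + 2) - p (i + 1)) = reflect_dir (y - x) (sgn (p (i + 1) - p i))"
      using p unfolding periodic_billiard_path_def interior_inner_quad by fast
    have 1: "T (p (i + 1)) \<in> open_segment (T x) (T y)" using xy(2) seg by blast
    have 2: "T (p i) \<noteq> T (p (i + 1))" using xy(3) inj by simp
    have 3: "open_segment (T (p i)) (T (p (i + 1))) \<subseteq> inner_quad A' B' C' D'"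
      using xy(4) inn by (auto simp: seg)
    have 4: "sgn (T (p (i + 2)) - T (p (i + 1))) = reflect_dir (T y - T x) (sgn (T (p (i + 1)) - T (p i)))"
      by (simp only: sg xy(5) refl)
    have 5: "sgn (T (p (i + 2)) - T (p (i + 1))) = reflect_dir (T x - T y) (sgn (T (p (i + 1)) - T (p i)))"
      using 4 reflect_dir_minus[of "T y - T x"] by simp
    show "\<exists>(x, y)\<in>cyclic_sides A' B' C' D'. T (p (i + 1)) \<in> open_segment x y \<and> T (p i) \<noteq> T (p (i + 1)) \<and>
        open_segment (T (p i)) (T (p (i + 1))) \<subseteq> inner_quad A' B' C' D' \<and>
        sgn (T (p (i + 2)) - T (p (i + 1))) = reflect_dir (y - x) (sgn (T (p (i + 1)) - T (p i)))"
      using sides[OF xy(1)]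
    proof
      assume "(T x, T y) \<in> cyclic_sides A' B' C' D'"
      then show ?thesis using 1 2 3 4 by (intro bexI[of _ "(T x, T y)"]) auto
    next
      assume "(T y, T x) \<in> cyclic_sides A' B' C' D'"
      then show ?thesis using 1 2 3 5
        by (intro bexI[of _ "(T y, T x)"]) (auto simp: open_segment_commute)
    qed
  qed
  then show ?thesis unfolding billiard_quad_def by blast
qed

lemma billiard_quad_affine:
  assumes "m \<noteq> 0" "billiard_quad A B C D"
  shows "billiard_quad (m * A + k) (m * B + k) (m * C + k) (m * D + k)"
proof (rule billiard_quad_map[where T = "\<lambda>z. m * z + k" and s = True and k = k, OF _ assms(1) _ _ assms(2)])
  have *: "(m * x + k) - (m * y + k) = m * (x - y)" for x y by (simp add: algebra_simps)
  show "m * z + k \<in> inner_quad (m * A + k) (m * B + k) (m * C + k) (m * D + k)"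
    if "z \<in> inner_quad A B C D" for z
    using that assms(1) unfolding inner_quad_def mem_Collect_eq * cross_similar
    by (simp add: zero_less_mult_iff)
qed (auto simp: flip_def cyclic_sides_def)

text \<open>The order B, A, D, C makes the mirror image counterclockwise again and keeps the side AB
  in front with its ends exchanged.\<close>

lemma billiard_quad_cnj:
  assumes "billiard_quad (cnj B) (cnj A) (cnj D) (cnj C)"
  shows "billiard_quad A B C D"
proof (rule billiard_quad_map[where T = cnj and s = False and m = 1 and k = 0, OF _ _ _ _ assms])
  show "cnj z \<in> inner_quad A B C D"
    if "z \<in> inner_quad (cnj B) (cnj A) (cnj D) (cnj C)" for z
  proof -
    have *: "cross (cnj x - cnj y) (z - cnj y) = cross (y - x) (cnj z - x)" for x y
      by (simp add: cross_alt algebra_simps)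
    show ?thesis
      using that unfolding inner_quad_def mem_Collect_eq *[of A B] *[of B C] *[of C D] *[of D A] by simp
  qed
  show "(cnj x, cnj y) \<in> cyclic_sides A B C D \<or> (cnj y, cnj x) \<in> cyclic_sides A B C D"
    if "(x, y) \<in> cyclic_sides (cnj B) (cnj A) (cnj D) (cnj C)" for x y
    using that unfolding cyclic_sides_def insert_iff empty_iff prod.inject
    by (elim disjE conjE) simp_all
qed (simp_all add: flip_def)

lemma billiard_quad_rotate: "billiard_quad B C D A = billiard_quad A B C D"
proof -
  have "inner_quad B C D A = inner_quad A B C D" by (auto simp: inner_quad_def)
  moreover have "cyclic_sides B C D A = cyclic_sides A B C D" by (auto simp: cyclic_sides_def)
  ultimately show ?thesis by (simp add: billiard_quad_def)
qed

lemma convex_quad_rotate: "convex_quad B C D A = convex_quad A B C D"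
  by (auto simp: convex_quad_def)

section \<open>Estimates that keep the far vertices off the path\<close>

lemma cos_ge: "cos x \<ge> 1 - x\<^sup>2 / 2" for x :: real
proof -
  have "\<bar>sin (x / 2)\<bar> \<le> \<bar>x / 2\<bar>" by (rule abs_sin_x_le_abs_x)
  then have "(sin (x / 2))\<^sup>2 \<le> (x / 2)\<^sup>2" by (simp only: abs_le_square_iff)
  then show ?thesis using cos_double_sin[of "x / 2"] by (simp add: power2_eq_square)
qed

lemma cos_ge_nine_tenths:
  assumes "\<bar>x\<bar> \<le> 2 / 5" shows "cos x \<ge> 9 / (10 :: real)"
proof -
  have "x\<^sup>2 \<le> (2 / 5)\<^sup>2" using assms by (metis abs_le_square_iff abs_numeral abs_divide)
  then show ?thesis using cos_ge[of x] by (simp add: power2_eq_square)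
qed

lemma Im_cis_mult_ge:
  assumes "\<bar>x\<bar> \<le> 2 / 5" "Im w \<ge> y" "y \<ge> 0" "cmod w \<le> M"
  shows "Im (cis x * w) \<ge> 9 / 10 * y - \<bar>x\<bar> * M"
proof -
  have "cos x * Im w \<ge> 9 / 10 * y"
    using assms cos_ge_nine_tenths[OF assms(1)] by (intro mult_mono) auto
  moreover have "\<bar>sin x * Re w\<bar> \<le> \<bar>x\<bar> * M"
    unfolding abs_mult using assms(4) abs_Re_le_cmod[of w] abs_sin_x_le_abs_x[of x]
    by (intro mult_mono) auto
  ultimately show ?thesis by simp
qed

text \<open>The exponent comes from \<open>diagonal_bounds\<close> below: at a diagonal slit the other two vertices
are only known to be at distance of order \<open>\<eta> ^ 5\<close> from it, and tilting moves them by an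
amount of order \<open>slack \<eta> / \<eta>\<^sup>2\<close>.\<close>

definition slack :: "real \<Rightarrow> real" where
  "slack \<eta> = \<eta> ^ 7 / 2000"

lemma slack_bounds:
  assumes "0 < \<eta>" "\<eta> \<le> 1"
  shows "0 < slack \<eta>" "slack \<eta> \<le> 1 / 2000" "slack \<eta> \<le> \<eta> / 2000" "slack \<eta> \<le> \<eta> ^ 5 / 2000"
    "slack \<eta> / \<eta>\<^sup>2 = \<eta> ^ 5 / 2000"
proof -
  have "\<eta> ^ 7 \<le> 1" "\<eta> ^ 7 \<le> \<eta>" "\<eta> ^ 7 \<le> \<eta> ^ 5" "\<eta> ^ 7 > 0"
    using assms power_decreasing[of 1 7 \<eta>] power_decreasing[of 5 7 \<eta>] power_le_one[of \<eta> 7] by auto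
  moreover have "\<eta> ^ 7 / \<eta>\<^sup>2 = \<eta> ^ 5"
    using assms power_diff[of \<eta> 2 7] by simp
  ultimately show "0 < slack \<eta>" "slack \<eta> \<le> 1 / 2000" "slack \<eta> \<le> \<eta> / 2000"
    "slack \<eta> \<le> \<eta> ^ 5 / 2000" "slack \<eta> / \<eta>\<^sup>2 = \<eta> ^ 5 / 2000"
    by (simp_all add: slack_def)
qed

text \<open>The sides attached to the slit have length at least \<eta>, while the word lives at
  scale \<open>slack \<eta>\<close>, at most \<eta> / 2000; hence \<open>B\<close> can be 100 times
  the slack.\<close>

lemma billiard_adjacent_normal:
  assumes \<eta>: "0 < \<eta>" "\<eta> \<le> 1" and ac: "a > 0" "3 * c \<le> a" "\<bar>a\<bar> \<le> slack \<eta>" "\<bar>c\<bar> \<le> slack \<eta>"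
    and q: "convex_quad 0 1 v2 v3" and c0: "corner \<eta> v3 0 1 c" and c1: "corner \<eta> 0 1 v2 (- a)"
  shows "billiard_quad 0 1 v2 v3"
proof -
  define \<epsilon> where "\<epsilon> = slack \<eta>"
  note \<epsilon> = slack_bounds[OF \<eta>, folded \<epsilon>_def]
  obtain \<sigma> \<phi> H K where w: "slit_word a c \<sigma> \<phi> H K" and \<phi>: "\<And>k. \<bar>\<phi> k\<bar> \<le> 7 * \<epsilon>"
    and H: "\<And>k. \<bar>H k\<bar> < 100 * \<epsilon>"
    using word_exists[of a c \<epsilon>, OF ac(1,2) ac(3,4)[folded \<epsilon>_def]] \<epsilon>(2)
    unfolding word_within_def by (simp, elim exE conjE, blast)
  obtain r3 where r3: "\<eta> \<le> r3" "v3 = r3 *\<^sub>R (\<i> * cis c)"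
    using c0 by (auto simp: corner_def)
  obtain \<rho> where \<rho>: "\<eta> \<le> \<rho>" "\<rho> \<le> 1 / \<eta>" "0 - 1 = \<rho> *\<^sub>R (\<i> * cis (- a) * (v2 - 1))"
    using c1 unfolding corner_def by blast
  have \<rho>0: "\<rho> > 0" using \<rho> \<eta> by linarith
  have "\<i> * cis a * (0 - 1) = \<i> * cis a * \<rho> *\<^sub>R (\<i> * cis (- a) * (v2 - 1))"
    using \<rho>(3) by simp
  also have "\<dots> = - (\<rho> *\<^sub>R ((cis a * cis (- a)) * (v2 - 1)))"
    by (simp add: scaleR_conv_of_real algebra_simps)
  finally have "\<i> * cis a = \<rho> *\<^sub>R (v2 - 1)" by (simp add: cis_mult)
  then have "(1 / \<rho>) *\<^sub>R (\<i> * cis a) = v2 - 1" using \<rho>0 by simp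
  then have v2: "v2 = 1 + (1 / \<rho>) *\<^sub>R (\<i> * cis a)" by simp
  have r1: "\<eta> \<le> 1 / \<rho>" using \<rho> \<rho>0 \<eta> by (simp add: field_simps)
  have far: "r * cos x \<ge> 100 * \<epsilon>" if "\<bar>x\<bar> \<le> 8 * \<epsilon>" "r \<ge> \<eta>" for r x
  proof -
    have "cos x \<ge> 9 / 10" using that \<epsilon> by (intro cos_ge_nine_tenths) auto
    then have "r * cos x \<ge> \<eta> * (9 / 10)" using that \<eta> by (intro mult_mono) auto
    then show ?thesis using \<epsilon> by linarith
  qed
  have ac': "\<bar>a\<bar> \<le> \<epsilon>" "\<bar>c\<bar> \<le> \<epsilon>" using ac by (auto simp: \<epsilon>_def)
  show ?thesis
  proof (rule slit_word.billiard_adjacent[OF w v2 r3(2) q H])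
    fix k
    show "100 * \<epsilon> \<le> 1 / \<rho> * cos (\<phi> k + a)" "100 * \<epsilon> \<le> 1 / \<rho> * cos (\<phi> k - a)"
      "100 * \<epsilon> \<le> r3 * cos (\<phi> k + c)" "100 * \<epsilon> \<le> r3 * cos (\<phi> k - c)"
      using \<phi>[of k] ac' r1 r3 by (intro far; linarith)+
  qed
qed


text \<open>The two corner relations form a linear system for \<open>vb\<close> and
  \<open>vt\<close> with determinant \<open>D\<close>. Solving it and multiplying by
  \<open>cnj D\<close> gives imaginary parts with numerators of size at least \<eta> / 2 over the
  denominator |D|^2, which is at most 4 / \<eta>^4.\<close>

lemma diagonal_bounds:
  assumes \<eta>: "0 < \<eta>" "\<eta> \<le> 1" and ac: "\<bar>a\<bar> \<le> slack \<eta>" "\<bar>c\<bar> \<le> slack \<eta>"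
    and c0: "corner \<eta> vt 0 vb c" and c1: "corner \<eta> vb 1 vt (- a)"
  shows "Im vt \<ge> \<eta> ^ 5 / 8" "- Im vb \<ge> \<eta> ^ 5 / 8"
    "cmod vt \<le> 3 / \<eta>\<^sup>2" "cmod (vt - 1) \<le> 3 / \<eta>\<^sup>2" "cmod vb \<le> 3 / \<eta>\<^sup>2" "cmod (vb - 1) \<le> 3 / \<eta>\<^sup>2"
proof -
  define \<epsilon> where "\<epsilon> = slack \<eta>"
  note \<epsilon> = slack_bounds[OF \<eta>, folded \<epsilon>_def]
  obtain \<rho> where \<rho>: "\<eta> \<le> \<rho>" "\<rho> \<le> 1 / \<eta>" "vt = \<rho> *\<^sub>R (\<i> * cis c * vb)"
    using c0 by (auto simp: corner_def)
  obtain \<rho>' where \<rho>': "\<eta> \<le> \<rho>'" "\<rho>' \<le> 1 / \<eta>" "vb - 1 = \<rho>' *\<^sub>R (\<i> * cis (- a) * (vt - 1))"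
    using c1 unfolding corner_def by blast
  have pos: "\<rho> > 0" "\<rho>' > 0" using \<rho> \<rho>' \<eta> by auto
  have small: "\<rho> * \<epsilon> \<le> 1 / 2000" "\<rho>' * \<epsilon> \<le> 1 / 2000"
  proof -
    have "(1 / \<eta>) * \<epsilon> \<le> 1 / 2000" using \<epsilon> \<eta> by (simp add: field_simps)
    moreover have "\<rho> * \<epsilon> \<le> (1 / \<eta>) * \<epsilon>" "\<rho>' * \<epsilon> \<le> (1 / \<eta>) * \<epsilon>"
      using \<rho> \<rho>' \<epsilon> by (intro mult_right_mono; simp)+
    ultimately show "\<rho> * \<epsilon> \<le> 1 / 2000" "\<rho>' * \<epsilon> \<le> 1 / 2000" by linarith+
  qed
  have le_mult: "\<bar>p * x\<bar> \<le> p * e" if "\<bar>x\<bar> \<le> e" "p > 0" for p x e :: real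
    using that by (simp add: abs_mult)
  define k s where "k = cos (c - a)" and "s = sin (c - a)"
  define D where "D = 1 + (\<rho> * \<rho>') *\<^sub>R cis (c - a)"
  have cosines: "cos a \<ge> 9 / 10" "cos c \<ge> 9 / 10" "k \<ge> 9 / 10"
    unfolding k_def using ac[folded \<epsilon>_def] \<epsilon>(2) by (intro cos_ge_nine_tenths; linarith)+
  have sines: "\<bar>sin a\<bar> \<le> \<epsilon>" "\<bar>sin c\<bar> \<le> \<epsilon>" "\<bar>s\<bar> \<le> 2 * \<epsilon>"
    unfolding s_def using ac abs_sin_x_le_abs_x[of a] abs_sin_x_le_abs_x[of c] abs_sin_x_le_abs_x[of "c - a"]
    by (auto simp: \<epsilon>_def)
  have D: "Re D = 1 + \<rho> * \<rho>' * k" "Im D = \<rho> * \<rho>' * s"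
    by (simp_all add: D_def k_def s_def)
  have vbD: "vb * D = 1 - \<rho>' *\<^sub>R (\<i> * cis (- a))"
  proof -
    have "vb - 1 = \<rho>' *\<^sub>R (\<i> * cis (- a) * (\<rho> *\<^sub>R (\<i> * cis c * vb) - 1))"
      using \<rho>'(3) unfolding \<rho>(3) .
    also have "\<dots> = - (\<rho> * \<rho>') *\<^sub>R (cis c * cis (- a)) * vb - \<rho>' *\<^sub>R (\<i> * cis (- a))"
      by (simp add: scaleR_conv_of_real algebra_simps)
    finally show ?thesis
      by (simp add: D_def cis_mult scaleR_conv_of_real algebra_simps)
  qed
  have vtD: "vt * D = \<rho> *\<^sub>R (\<i> * cis c) + (\<rho> * \<rho>') *\<^sub>R cis (c - a)"
  proof -
    have "vt * D = \<rho> *\<^sub>R (\<i> * cis c * (vb * D))" by (simp add: \<rho>(3))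
    also have "\<dots> = \<rho> *\<^sub>R (\<i> * cis c) + (\<rho> * \<rho>') *\<^sub>R (cis c * cis (- a))"
      unfolding vbD by (simp add: scaleR_conv_of_real algebra_simps)
    finally show ?thesis by (simp add: cis_mult)
  qed
  have rr: "0 < \<rho> * \<rho>'" "\<rho> * \<rho>' \<le> 1 / \<eta>\<^sup>2"
  proof -
    show "0 < \<rho> * \<rho>'" using pos by simp
    have "\<rho> * \<rho>' \<le> (1 / \<eta>) * (1 / \<eta>)" using \<rho> \<rho>' pos \<eta> by (intro mult_mono) auto
    then show "\<rho> * \<rho>' \<le> 1 / \<eta>\<^sup>2" by (simp add: power2_eq_square)
  qed
  have one: "1 \<le> 1 / \<eta>" "1 / \<eta> \<le> 1 / \<eta>\<^sup>2"
    using \<eta> by (auto simp: field_simps power2_eq_square)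
  have D1: "cmod D \<ge> 1"
  proof -
    have "Re D \<ge> 1" using rr cosines by (simp add: D)
    then show ?thesis using complex_Re_le_cmod[of D] by linarith
  qed
  have "cmod D \<le> 2 / \<eta>\<^sup>2"
    using norm_triangle_ineq[of 1 "(\<rho> * \<rho>') *\<^sub>R cis (c - a)"] rr one by (simp add: D_def)
  then have "(cmod D)\<^sup>2 \<le> (2 / \<eta>\<^sup>2)\<^sup>2" using D1 by (intro power_mono) auto
  then have D2: "(cmod D)\<^sup>2 \<le> 4 / \<eta> ^ 4" by (simp add: power_divide flip: power_mult)
  have Im_D: "Im z * (cmod D)\<^sup>2 = Im (z * D) * Re D - Re (z * D) * Im D" for z
    unfolding cmod_power2 by (simp add: algebra_simps power2_eq_square)
  have lower: "x \<ge> \<eta> ^ 5 / 8" if "x * (cmod D)\<^sup>2 \<ge> \<eta> / 2" for x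
  proof -
    have "x * (cmod D)\<^sup>2 > 0" using that \<eta> by linarith
    then have "x > 0" by (simp add: zero_less_mult_iff)
    then have "x * (4 / \<eta> ^ 4) \<ge> \<eta> / 2"
      using that mult_left_mono[OF D2, of x] by linarith
    from mult_right_mono[OF this, of "\<eta> ^ 4 / 4"]
    have "\<eta> / 2 * (\<eta> ^ 4 / 4) \<le> x" using \<eta> by simp
    moreover have "\<eta> / 2 * (\<eta> ^ 4 / 4) = \<eta> ^ 5 / 8" by (simp add: eval_nat_numeral)
    ultimately show ?thesis by simp
  qed
  \<comment> \<open>The term with \<open>cos a\<close> dominates with at least 9/10; the other one
    carries the factor \<open>s\<close>, the sine of \<open>c - a\<close>, and is at most
    1/500.\<close>
  have "- Im vb * (cmod D)\<^sup>2 = \<rho>' * (cos a * (1 + \<rho> * \<rho>' * k) + (1 - \<rho>' * sin a) * (\<rho> * s))"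
    using Im_D[of vb] unfolding vbD D by (simp add: algebra_simps)
  moreover have "cos a * (1 + \<rho> * \<rho>' * k) + (1 - \<rho>' * sin a) * (\<rho> * s) \<ge> 1 / 2"
  proof -
    have "\<bar>\<rho>' * sin a\<bar> \<le> 1" 
      using le_mult[OF sines(1) pos(2)] small(2) by simp
    moreover have rs: "\<bar>\<rho> * s\<bar> \<le> 1 / 1000"
      using le_mult[OF sines(3) pos(1)] small(1) by simp
    ultimately have "\<bar>(1 - \<rho>' * sin a) * (\<rho> * s)\<bar> \<le> 2 * (1 / 1000)"
      unfolding abs_mult[of "1 - _"] by (intro mult_mono) auto
    moreover have "cos a * (1 + \<rho> * \<rho>' * k) \<ge> 9 / 10 * 1"
      using cosines rr by (intro mult_mono) auto
    ultimately show ?thesis by linarith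
  qed
  ultimately have "- Im vb * (cmod D)\<^sup>2 \<ge> \<rho>' * (1 / 2)"
    using pos mult_left_mono[of "1 / 2" _ \<rho>'] by simp
  then show "- Im vb \<ge> \<eta> ^ 5 / 8" using \<rho>'(1) by (intro lower) linarith
  have "Im vt * (cmod D)\<^sup>2 = \<rho> * (cos c * (1 + \<rho> * \<rho>' * k) + (1 + \<rho> * sin c) * (\<rho>' * s))"
    using Im_D[of vt] unfolding vtD D
    by (simp add: k_def[symmetric] s_def[symmetric] algebra_simps)
  moreover have "cos c * (1 + \<rho> * \<rho>' * k) + (1 + \<rho> * sin c) * (\<rho>' * s) \<ge> 1 / 2"
  proof -
    have "\<bar>\<rho> * sin c\<bar> \<le> 1" 
      using le_mult[OF sines(2) pos(1)] small(1) by simp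
    moreover have rs: "\<bar>\<rho>' * s\<bar> \<le> 1 / 1000"
      using le_mult[OF sines(3) pos(2)] small(2) by simp
    ultimately have "\<bar>(1 + \<rho> * sin c) * (\<rho>' * s)\<bar> \<le> 2 * (1 / 1000)"
      unfolding abs_mult[of "1 + _"] by (intro mult_mono) auto
    moreover have "cos c * (1 + \<rho> * \<rho>' * k) \<ge> 9 / 10 * 1"
      using cosines rr by (intro mult_mono) auto
    ultimately show ?thesis by linarith
  qed
  ultimately have "Im vt * (cmod D)\<^sup>2 \<ge> \<rho> * (1 / 2)"
    using pos mult_left_mono[of "1 / 2" _ \<rho>] by simp
  then show "Im vt \<ge> \<eta> ^ 5 / 8" using \<rho>(1) by (intro lower) linarith
  have le: "cmod z \<le> M" if "cmod (z * D) \<le> M" for z M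
    using that D1 mult_left_mono[OF D1, of "cmod z"] by (simp add: norm_mult)
  have "cmod (vb * D) \<le> 1 + \<rho>'"
    unfolding vbD using norm_triangle_ineq4[of 1 "\<rho>' *\<^sub>R (\<i> * cis (- a))"] pos by (simp add: norm_mult)
  then have vb: "cmod vb \<le> 1 + 1 / \<eta>" using le \<rho>' by force
  then show "cmod vb \<le> 3 / \<eta>\<^sup>2" using one by (simp add: add_divide_distrib)
  have vb1: "cmod (vb - 1) \<le> 3 / \<eta>" using norm_triangle_ineq4[of vb 1] vb one by simp
  then show "cmod (vb - 1) \<le> 3 / \<eta>\<^sup>2" using one by simp
  have "cmod (vt * D) \<le> \<rho> + \<rho> * \<rho>'"
    unfolding vtD using norm_triangle_ineq[of "\<rho> *\<^sub>R (\<i> * cis c)" "(\<rho> * \<rho>') *\<^sub>R cis (c - a)"] pos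
    by (simp add: norm_mult)
  then have "cmod vt \<le> \<rho> + \<rho> * \<rho>'" by (rule le)
  then show "cmod vt \<le> 3 / \<eta>\<^sup>2" using rr \<rho> one by (simp add: add_divide_distrib)
  have "cmod (vb - 1) = \<rho>' * cmod (vt - 1)"
    unfolding \<rho>'(3) using pos by (simp add: norm_mult)
  then have "\<eta> * cmod (vt - 1) \<le> 3 / \<eta>"
    using vb1 mult_right_mono[OF \<rho>'(1), of "cmod (vt - 1)"] by simp
  then show "cmod (vt - 1) \<le> 3 / \<eta>\<^sup>2" using \<eta> by (simp add: field_simps power2_eq_square)
qed

lemma billiard_diagonal_normal:
  assumes \<eta>: "0 < \<eta>" "\<eta> \<le> 1" and ac: "a > 0" "3 * c \<le> a" "\<bar>a\<bar> \<le> slack \<eta>" "\<bar>c\<bar> \<le> slack \<eta>"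
    and q: "convex_quad 0 vb 1 vt" and c0: "corner \<eta> vt 0 vb c" and c1: "corner \<eta> vb 1 vt (- a)"
  shows "billiard_quad 0 vb 1 vt"
proof -
  define \<epsilon> where "\<epsilon> = slack \<eta>"
  note \<epsilon> = slack_bounds[OF \<eta>, folded \<epsilon>_def]
  obtain \<sigma> \<phi> H K where w: "slit_word a c \<sigma> \<phi> H K" and \<phi>: "\<And>k. \<bar>\<phi> k\<bar> \<le> 7 * \<epsilon>"
    and H: "\<And>k. \<bar>H k\<bar> < 100 * \<epsilon>"
    using word_exists[of a c \<epsilon>, OF ac(1,2) ac(3,4)[folded \<epsilon>_def]] \<epsilon>(2)
    unfolding word_within_def by (simp, elim exE conjE, blast)
  obtain \<rho> where \<rho>: "vt = \<rho> *\<^sub>R (\<i> * cis c * vb)"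
    using c0 by (auto simp: corner_def)
  obtain \<rho>' where \<rho>': "vb - 1 = \<rho>' *\<^sub>R (\<i> * cis (- a) * (vt - 1))"
    using c1 unfolding corner_def by blast
  note b = diagonal_bounds[OF \<eta> ac(3,4) c0 c1]
  \<comment> \<open>In units of \<eta>^5, the height 9/80 loses at most 21/2000 by tilting, and the
    rest still exceeds 100/2000, a bound for 100 \<epsilon>.\<close>
  have far: "Im (cis (\<phi> k) * w) \<ge> 100 * \<epsilon>" if "Im w \<ge> \<eta> ^ 5 / 8" "cmod w \<le> 3 / \<eta>\<^sup>2" for k w
  proof -
    have "\<bar>\<phi> k\<bar> \<le> 2 / 5" using \<phi>[of k] \<epsilon> by linarith
    then have "Im (cis (\<phi> k) * w) \<ge> 9 / 10 * (\<eta> ^ 5 / 8) - \<bar>\<phi> k\<bar> * (3 / \<eta>\<^sup>2)"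
      using that \<eta> by (intro Im_cis_mult_ge) auto
    moreover have "\<bar>\<phi> k\<bar> * (3 / \<eta>\<^sup>2) \<le> (7 * \<epsilon>) * (3 / \<eta>\<^sup>2)"
      using \<phi>[of k] by (intro mult_right_mono) auto
    moreover have "(7 * \<epsilon>) * (3 / \<eta>\<^sup>2) = 21 * (\<eta> ^ 5 / 2000)"
      using \<epsilon>(5) by simp
    moreover have "\<eta> ^ 5 > 0" using \<eta> by simp
    ultimately show ?thesis using \<epsilon>(4) by linarith
  qed
  have far': "Im (cis (\<phi> k) * w) \<le> - (100 * \<epsilon>)" if "- Im w \<ge> \<eta> ^ 5 / 8" "cmod w \<le> 3 / \<eta>\<^sup>2" for k w
    using far[of "- w" k] that by simp
  show ?thesis
  proof (rule slit_word.billiard_diagonal[OF w \<rho> \<rho>' q H])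
    fix k
    show "100 * \<epsilon> \<le> Im (cis (\<phi> k) * vt)" "100 * \<epsilon> \<le> Im (cis (\<phi> k) * (vt - 1))"
      by (rule far; use b in simp)+
    show "Im (cis (\<phi> k) * vb) \<le> - (100 * \<epsilon>)" "Im (cis (\<phi> k) * (vb - 1)) \<le> - (100 * \<epsilon>)"
      by (rule far'; use b in simp)+
  qed
qed

section \<open>Normalization and choice of the slit\<close>

lemma billiard_adjacent_corners:
  assumes \<eta>: "0 < \<eta>" "\<eta> \<le> 1" and ac: "a > 0" "3 * c \<le> a" "\<bar>a\<bar> \<le> slack \<eta>" "\<bar>c\<bar> \<le> slack \<eta>"
    and q: "convex_quad A B C D" and c0: "corner \<eta> D A B c" and c1: "corner \<eta> A B C (- a)"
  shows "billiard_quad A B C D"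
proof -
  define m where "m = B - A"
  have m: "m \<noteq> 0" using convex_quad_distinct[OF q] by (auto simp: m_def)
  define v2 v3 where "v2 = (C - A) / m" and "v3 = (D - A) / m"
  have e: "m + A = B" "m * v2 + A = C" "m * v3 + A = D"
    using m by (simp_all add: v2_def v3_def m_def)
  have "convex_quad 0 1 v2 v3"
    using q convex_quad_affine[OF m, of 0 A 1 v2 v3] by (simp add: e)
  moreover have "corner \<eta> v3 0 1 c"
    using c0 corner_affine[OF m, of \<eta> v3 A 0 1 c] by (simp add: e)
  moreover have "corner \<eta> 0 1 v2 (- a)"
    using c1 corner_affine[OF m, of \<eta> 0 A 1 v2 "- a"] by (simp add: e)
  ultimately have "billiard_quad 0 1 v2 v3"
    by (rule billiard_adjacent_normal[OF \<eta> ac])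
  from billiard_quad_affine[OF m this, of A] show ?thesis by (simp add: e)
qed

text \<open>The acute end of the slit is now its first vertex; the mirror image exchanges the two
  ends.\<close>

lemma billiard_adjacent_corners':
  assumes \<eta>: "0 < \<eta>" "\<eta> \<le> 1" and ac: "a > 0" "3 * c \<le> a" "\<bar>a\<bar> \<le> slack \<eta>" "\<bar>c\<bar> \<le> slack \<eta>"
    and q: "convex_quad A B C D" and c0: "corner \<eta> D A B (- a)" and c1: "corner \<eta> A B C c"
  shows "billiard_quad A B C D"
  by (rule billiard_quad_cnj, rule billiard_adjacent_corners[OF \<eta> ac _ corner_cnj[OF c1 \<eta>(1)]
      corner_cnj[OF c0 \<eta>(1)]]) (simp add: q convex_quad_cnj)

lemma billiard_diagonal_corners:
  assumes \<eta>: "0 < \<eta>" "\<eta> \<le> 1" and ac: "a > 0" "3 * c \<le> a" "\<bar>a\<bar> \<le> slack \<eta>" "\<bar>c\<bar> \<le> slack \<eta>"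
    and q: "convex_quad A B C D" and c0: "corner \<eta> D A B c" and c1: "corner \<eta> B C D (- a)"
  shows "billiard_quad A B C D"
proof -
  define m where "m = C - A"
  have m: "m \<noteq> 0" using convex_quad_distinct[OF q] by (auto simp: m_def)
  define vb vt where "vb = (B - A) / m" and "vt = (D - A) / m"
  have e: "m * vb + A = B" "m + A = C" "m * vt + A = D"
    using m by (simp_all add: vb_def vt_def m_def)
  have "convex_quad 0 vb 1 vt"
    using q convex_quad_affine[OF m, of 0 A vb 1 vt] by (simp add: e)
  moreover have "corner \<eta> vt 0 vb c"
    using c0 corner_affine[OF m, of \<eta> vt A 0 vb c] by (simp add: e)
  moreover have "corner \<eta> vb 1 vt (- a)"
    using c1 corner_affine[OF m, of \<eta> vb A 1 vt "- a"] by (simp add: e)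
  ultimately have "billiard_quad 0 vb 1 vt"
    by (rule billiard_diagonal_normal[OF \<eta> ac])
  from billiard_quad_affine[OF m this, of A] show ?thesis by (simp add: e)
qed

text \<open>The other three deviations add up to -\<alpha>, so one of them is at most a third of it.
  Its vertex is next, opposite or previous to \<open>A\<close>, and the slit is accordingly the side
  AB, the diagonal AC or the side DA.\<close>

lemma billiard_acute_corner:
  assumes \<eta>: "0 < \<eta>" "\<eta> \<le> 1" and q: "convex_quad A B C D"
    and A: "corner \<eta> D A B \<alpha>" and B: "corner \<eta> A B C \<beta>" and C: "corner \<eta> B C D \<gamma>" and D: "corner \<eta> C D A \<delta>"
    and sum: "\<alpha> + \<beta> + \<gamma> + \<delta> = 0" and neg: "\<alpha> < 0"
    and small: "\<bar>\<alpha>\<bar> \<le> slack \<eta>" "\<bar>\<beta>\<bar> \<le> slack \<eta>" "\<bar>\<gamma>\<bar> \<le> slack \<eta>" "\<bar>\<delta>\<bar> \<le> slack \<eta>"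
  shows "billiard_quad A B C D"
proof -
  have A': "corner \<eta> D A B (- (- \<alpha>))" "- \<alpha> > 0" "\<bar>- \<alpha>\<bar> \<le> slack \<eta>" using A neg small by auto
  consider "3 * \<beta> \<le> - \<alpha>" | "3 * \<gamma> \<le> - \<alpha>" | "3 * \<delta> \<le> - \<alpha>" using sum by linarith
  then show ?thesis
  proof cases
    case 1
    then show ?thesis using billiard_adjacent_corners'[OF \<eta> A'(2) 1 A'(3) small(2) q A'(1) B] by simp
  next
    case 2
    then have "billiard_quad C D A B"
      using billiard_diagonal_corners[OF \<eta> A'(2) 2 A'(3) small(3) _ C A'(1)] q convex_quad_rotate[of B C D A] convex_quad_rotate[of C D A B] by simp
    then show ?thesis using billiard_quad_rotate[of B C D A] billiard_quad_rotate[of C D A B] by simp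
  next
    case 3
    then have "billiard_quad D A B C"
      using billiard_adjacent_corners[OF \<eta> A'(2) 3 A'(3) small(4) _ D A'(1)] q convex_quad_rotate[of A B C D] by simp
    then show ?thesis using billiard_quad_rotate[of A B C D] by simp
  qed
qed

lemma billiard_nonrectangular:
  assumes \<eta>: "0 < \<eta>" "\<eta> \<le> 1" and q: "convex_quad A B C D"
    and A: "corner \<eta> D A B \<alpha>" and B: "corner \<eta> A B C \<beta>" and C: "corner \<eta> B C D \<gamma>" and D: "corner \<eta> C D A \<delta>"
    and sum: "\<alpha> + \<beta> + \<gamma> + \<delta> = 0" and neg: "\<not> (\<alpha> = 0 \<and> \<beta> = 0 \<and> \<gamma> = 0 \<and> \<delta> = 0)"
    and small: "\<bar>\<alpha>\<bar> \<le> slack \<eta>" "\<bar>\<beta>\<bar> \<le> slack \<eta>" "\<bar>\<gamma>\<bar> \<le> slack \<eta>" "\<bar>\<delta>\<bar> \<le> slack \<eta>"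
  shows "billiard_quad A B C D"
proof -
  have r: "convex_quad B C D A" "convex_quad C D A B" "convex_quad D A B C"
    using q convex_quad_rotate[of B C D A] convex_quad_rotate[of C D A B] convex_quad_rotate[of D A B C] by simp_all
  consider "\<alpha> < 0" | "\<beta> < 0" | "\<gamma> < 0" | "\<delta> < 0" using sum neg by linarith
  then show ?thesis
  proof cases
    case 1
    then show ?thesis using billiard_acute_corner[OF \<eta> q A B C D sum _ small] by simp
  next
    case 2
    have "billiard_quad B C D A"
      by (rule billiard_acute_corner[OF \<eta> r(1) B C D A]) (use sum 2 small in auto)
    then show ?thesis using billiard_quad_rotate[of B C D A] billiard_quad_rotate[of C D A B] billiard_quad_rotate[of A B C D]
      by simp
  next
    case 3
    have "billiard_quad C D A B"
      by (rule billiard_acute_corner[OF \<eta> r(2) C D A B]) (use sum 3 small in auto)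
    then show ?thesis using billiard_quad_rotate[of B C D A] billiard_quad_rotate[of C D A B] billiard_quad_rotate[of A B C D]
      by simp
  next
    case 4
    have "billiard_quad D A B C"
      by (rule billiard_acute_corner[OF \<eta> r(3) D A B C]) (use sum 4 small in auto)
    then show ?thesis using billiard_quad_rotate[of B C D A] billiard_quad_rotate[of C D A B] billiard_quad_rotate[of A B C D]
      by simp
  qed
qed

section \<open>Quadrilaterals near a rectangle\<close>

lemma corner_cross_pos:
  assumes "corner \<eta> A B C \<alpha>" "\<eta> > 0" "\<bar>\<alpha>\<bar> < pi / 2" "C \<noteq> B"
  shows "cross (C - B) (A - B) > 0"
proof -
  obtain \<rho> where \<rho>: "\<eta> \<le> \<rho>" "A - B = \<rho> *\<^sub>R (\<i> * cis \<alpha> * (C - B))"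
    using assms by (auto simp: corner_def)
  have "cross (C - B) (A - B) = \<rho> * cos \<alpha> * (cmod (C - B))\<^sup>2"
    unfolding \<rho>(2) cmod_power2 by (simp add: cross_alt algebra_simps power2_eq_square)
  moreover have "cos \<alpha> > 0" using assms by (intro cos_gt_zero_pi) auto
  ultimately show ?thesis using \<rho> assms by simp
qed

text \<open>The three cross products divided by that of the whole triangle are the barycentric
  coordinates of \<open>z\<close>.\<close>

lemma mem_triangle:
  assumes T: "cross (B - A) (C - A) > 0" and z: "cross (B - A) (z - A) \<ge> 0"
    "cross (C - B) (z - B) \<ge> 0" "cross (A - C) (z - C) \<ge> 0"
  shows "z \<in> convex hull {A, B, C}"
proof -
  define t where "t = cross (B - A) (C - A)"
  define u v w where "u = cross (C - B) (z - B) / t" and "v = cross (A - C) (z - C) / t"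
    and "w = cross (B - A) (z - A) / t"
  have t: "t > 0" using T by (simp add: t_def)
  have "t * u + t * v + t * w = t"
    using t by (simp add: u_def v_def w_def) (simp add: t_def cross_alt algebra_simps)
  then have "t * (u + v + w) = t * 1" by (simp add: algebra_simps)
  then have "u + v + w = 1" using t by simp
  moreover have "u \<ge> 0" "v \<ge> 0" "w \<ge> 0" using z t by (auto simp: u_def v_def w_def)
  moreover have "t *\<^sub>R z = t *\<^sub>R (u *\<^sub>R A + v *\<^sub>R B + w *\<^sub>R C)"
  proof -
    have "t *\<^sub>R (u *\<^sub>R A + v *\<^sub>R B + w *\<^sub>R C) = (t * u) *\<^sub>R A + (t * v) *\<^sub>R B + (t * w) *\<^sub>R C"
      by (simp add: algebra_simps)
    also have "\<dots> = t *\<^sub>R z"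
      using t by (simp add: u_def v_def w_def) (simp add: complex_eq_iff t_def cross_alt algebra_simps)
    finally show ?thesis ..
  qed
  ultimately show ?thesis using t by (auto simp: convex_hull_3)
qed

text \<open>The side of the diagonal AC on which the point lies selects the triangle.\<close>

lemma inner_quad_subset:
  assumes "convex_quad A B C D"
  shows "inner_quad A B C D \<subseteq> convex hull {A, B, C} \<union> convex hull {A, C, D}"
proof
  fix z assume z: "z \<in> inner_quad A B C D"
  have minus: "cross (A - C) (z - C) = - cross (C - A) (z - A)"
    by (simp add: cross_alt algebra_simps)
  have T: "cross (B - A) (C - A) > 0" "cross (C - A) (D - A) > 0"
    using assms cross_cyc[of C A D] by (simp_all add: convex_quad_def)
  show "z \<in> convex hull {A, B, C} \<union> convex hull {A, C, D}"
  proof (cases "cross (C - A) (z - A) \<ge> 0")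
    case True
    then have "z \<in> convex hull {A, C, D}"
      using z T by (intro mem_triangle) (auto simp: inner_quad_def)
    then show ?thesis ..
  next
    case False
    then have "z \<in> convex hull {A, B, C}"
      using z T by (intro mem_triangle) (auto simp: inner_quad_def minus)
    then show ?thesis ..
  qed
qed

text \<open>The segment joining the midpoints of AB and CD is perpendicular to both sides and is
  traversed back and forth.\<close>

lemma billiard_rectangle:
  assumes q: "convex_quad A B C D" and par: "C - B = D - A"
    and perp: "D - A = \<rho> *\<^sub>R (\<i> * (B - A))" and \<rho>: "\<rho> > 0"
  shows "billiard_quad A B C D"
proof -
  define p where "p i = (if even i then midpoint A B else midpoint C D)" for i :: nat
  define S where "S i = (if even i then (A, B) else (C, D))" for i :: nat
  have d: "distinct [A, B, C, D]" by (rule convex_quad_distinct[OF q])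
  have S: "S i \<in> cyclic_sides A B C D" "S i \<noteq> S (Suc i)" for i
    using d by (auto simp: S_def cyclic_sides_def)
  have pS: "p i \<in> open_segment (fst (S i)) (snd (S i))" for i
    using d by (auto simp: p_def S_def)
  have step: "p (Suc i) - p i = (if even i then D - A else - (D - A))" for i
  proof -
    have C: "C = B + (D - A)" using par by (simp add: algebra_simps)
    have "midpoint C D - midpoint A B = D - A"
      unfolding C by (simp add: midpoint_def scaleR_conv_of_real field_simps)
    then show ?thesis by (auto simp: p_def algebra_simps)
  qed
  have "reflect_dir (B - A) (sgn (D - A)) = - sgn (D - A)"
  proof -
    have s: "sgn (D - A) = \<i> * sgn (B - A)"
      unfolding perp using \<rho> by (simp add: sgn_scaleR sgn_mult) (simp add: sgn_eq)
    have "sgn (B - A) * cnj (sgn (B - A)) = 1"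
      using d by (metis complex_norm_square distinct_length_2_or_more norm_sgn of_real_1 power_one right_minus_eq)
    then show ?thesis unfolding reflect_dir_def s by (simp add: power2_eq_square mult.assoc)
  qed
  moreover have "reflect_dir v (- w) = - reflect_dir v w" for v w
    by (simp add: reflect_dir_def)
  moreover have "D - C = - (B - A)" using par by (simp add: algebra_simps)
  ultimately have law: "sgn (p (Suc (Suc i)) - p (Suc i)) =
      reflect_dir (snd (S (Suc i)) - fst (S (Suc i))) (sgn (p (Suc i) - p i))" for i
    using reflect_dir_minus[of "B - A"]
    unfolding step by (auto simp: S_def sgn_minus simp del: minus_diff_eq)
  have "periodic_billiard_path (inner_quad A B C D) (cyclic_sides A B C D) p 2"
    unfolding periodic_billiard_path_def interior_inner_quad
  proof (intro conjI allI)
    show "(2 :: nat) \<le> 2" "p (i + 2) = p i" for i by (simp_all add: p_def)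
    fix i
    have "p i \<noteq> p (i + 1)" using step[of i] d by (auto split: if_splits)
    moreover have "open_segment (p i) (p (i + 1)) \<subseteq> inner_quad A B C D"
      using open_segment_inner_quad[OF q, of "fst (S i)" "snd (S i)" "fst (S (Suc i))" "snd (S (Suc i))"]
        S[of i] S[of "Suc i"] pS[of i] pS[of "Suc i"] by auto
    ultimately show "\<exists>(x, y)\<in>cyclic_sides A B C D. p (i + 1) \<in> open_segment x y \<and> p i \<noteq> p (i + 1) \<and>
        open_segment (p i) (p (i + 1)) \<subseteq> inner_quad A B C D \<and>
        sgn (p (i + 2) - p (i + 1)) = reflect_dir (y - x) (sgn (p (i + 1) - p i))"
      using S(1)[of "Suc i"] pS[of "Suc i"] law[of i]
      by (intro bexI[of _ "S (Suc i)"]) (auto simp: case_prod_beta)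
  qed
  then show ?thesis unfolding billiard_quad_def by blast
qed

text \<open>The counterclockwise order is P, S, R, Q, whereas \<open>quad_sides\<close> runs
  clockwise; the reflection law is the same for a reversed side.\<close>

lemma has_path_of_billiard_quad:
  assumes q: "convex_quad (quad_P r) (quad_S r) (quad_R r) (quad_Q r)"
    and b: "billiard_quad (quad_P r) (quad_S r) (quad_R r) (quad_Q r)"
  shows "has_periodic_billiard_path r"
proof -
  let ?J = "inner_quad (quad_P r) (quad_S r) (quad_R r) (quad_Q r)"
  let ?S = "cyclic_sides (quad_P r) (quad_S r) (quad_R r) (quad_Q r)"
  have "?J \<subseteq> quad_region r"
    using inner_quad_subset[OF q] by (auto simp: quad_region_def insert_commute)
  then have J: "?J \<subseteq> interior (quad_region r)"
    by (simp add: interior_maximal open_inner_quad)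
  have S: "(y, x) \<in> quad_sides r" if "(x, y) \<in> ?S" for x y
    using that by (auto simp: cyclic_sides_def quad_sides_def)
  obtain p n where p: "periodic_billiard_path ?J ?S p n"
    using b by (auto simp: billiard_quad_def)
  have "periodic_billiard_path (quad_region r) (quad_sides r) p n"
    unfolding periodic_billiard_path_def
  proof (intro conjI allI)
    show "2 \<le> n" "p (i + n) = p i" for i
      using p by (simp_all add: periodic_billiard_path_def)
    fix i
    obtain x y where xy: "(x, y) \<in> ?S" "p (i + 1) \<in> open_segment x y"
        "p i \<noteq> p (i + 1)" "open_segment (p i) (p (i + 1)) \<subseteq> ?J"
        "sgn (p (i + 2) - p (i + 1)) = reflect_dir (y - x) (sgn (p (i + 1) - p i))"
      using p unfolding periodic_billiard_path_def interior_inner_quad by fast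
    have "reflect_dir (x - y) = reflect_dir (y - x)"
      using reflect_dir_minus[of "y - x"] by auto
    then show "\<exists>(x, y)\<in>quad_sides r. p (i + 1) \<in> open_segment x y \<and> p i \<noteq> p (i + 1) \<and>
        open_segment (p i) (p (i + 1)) \<subseteq> interior (quad_region r) \<and>
        sgn (p (i + 2) - p (i + 1)) = reflect_dir (y - x) (sgn (p (i + 1) - p i))"
      using S[OF xy(1)] xy J
      by (intro bexI[of _ "(y, x)"]) (auto simp: open_segment_commute)
  qed
  then show ?thesis unfolding has_periodic_billiard_path_def by blast
qed

section \<open>Corners in terms of the four parameters\<close>

lemma corner_of_polar:
  assumes A: "A - B = x *\<^sub>R cis \<beta>" and C: "C - B = y *\<^sub>R cis \<gamma>" and \<alpha>: "\<beta> = \<gamma> + \<alpha> + pi / 2"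
    and y: "y > 0" and \<eta>: "\<eta> \<le> x / y" "x / y \<le> 1 / \<eta>"
  shows "corner \<eta> A B C \<alpha>"
proof -
  have "cis \<beta> = \<i> * cis \<alpha> * cis \<gamma>"
    unfolding \<alpha> by (simp add: cis_mult algebra_simps flip: cis_pi_half)
  then have "A - B = (x / y) *\<^sub>R (\<i> * cis \<alpha> * (C - B))"
    unfolding A C using y by (simp add: scaleR_conv_of_real)
  then show ?thesis using \<eta> unfolding corner_def by blast
qed

text \<open>For the triangle on the base from 0 to 1 with angle \<open>y\<close> at 0, angle
  \<open>x\<close> at 1 and apex below, this puts the side from the apex to 1 in polar form.\<close>

lemma law_of_sines:
  assumes "sin (x + y) \<noteq> 0"
  shows "1 - (sin x / sin (x + y)) *\<^sub>R cis (- y) = (sin y / sin (x + y)) *\<^sub>R cis x"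
proof -
  have "sin (x + y) = sin x * cos y + cos x * sin y" by (rule sin_add)
  then show ?thesis using assms by (simp add: complex_eq_iff field_simps)
qed

text \<open>The interior angles at P, S, R, Q are a + d, pi - c - d, b + c and pi - a - b, with
  deviations from pi/2 that add up to 0. Ratios of adjacent sides are quotients of products of at
  most two sines, each between \<open>m\<close> and 1, so they lie between \<open>m\<^sup>2\<close>
  and its inverse.\<close>

lemma near_rectangle_has_path:
  fixes a b c d m :: real
  assumes m: "0 < m" "m \<le> 1" and sines: "m \<le> sin a" "m \<le> sin b" "m \<le> sin c" "m \<le> sin d"
      "m \<le> sin (a + b)" "m \<le> sin (c + d)"
    and small: "\<bar>a + d - pi / 2\<bar> \<le> slack (m\<^sup>2)" "\<bar>pi / 2 - c - d\<bar> \<le> slack (m\<^sup>2)"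
      "\<bar>b + c - pi / 2\<bar> \<le> slack (m\<^sup>2)" "\<bar>pi / 2 - a - b\<bar> \<le> slack (m\<^sup>2)"
  shows "has_periodic_billiard_path (a, b, c, d)"
proof -
  let ?r = "(a, b, c, d)"
  define P S R Q where "P = quad_P ?r" and "S = quad_S ?r" and "R = quad_R ?r" and "Q = quad_Q ?r"
  define sq ss sa sd where "sq = sin b / sin (a + b)" and "ss = sin c / sin (c + d)"
    and "sa = sin a / sin (a + b)" and "sd = sin d / sin (c + d)"
  define \<eta> where "\<eta> = m\<^sup>2"
  have \<eta>: "0 < \<eta>" "\<eta> \<le> 1" using m by (auto simp: \<eta>_def power_le_one)
  have nz: "sin (a + b) > 0" "sin (c + d) > 0" using sines m by auto
  have val: "P = 0" "R = 1" "Q = sq *\<^sub>R cis a" "S = ss *\<^sub>R cis (- d)"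
    by (simp_all add: P_def R_def Q_def S_def quad_P_def quad_Q_def quad_R_def quad_S_def
        sq_def ss_def scaleR_conv_of_real)
  have RS: "R - S = sd *\<^sub>R cis c"
    using law_of_sines[of c d] nz by (simp add: val ss_def sd_def)
  have "cnj (R - Q) = sa *\<^sub>R cis b"
    using law_of_sines[of b a] nz by (simp add: val sq_def sa_def cis_cnj add.commute)
  then have RQ: "R - Q = sa *\<^sub>R cis (- b)"
    by (metis cis_cnj complex_cnj_cnj complex_cnj_scaleR)
  have pos: "sq > 0" "ss > 0" "sa > 0" "sd > 0"
    using sines m by (auto simp: sq_def ss_def sa_def sd_def)
  have ratio1: "\<eta> \<le> x / y" if "m \<le> x" "m \<le> y" "x \<le> 1" "y \<le> 1" for x y
  proof -
    have "m * m \<le> m * 1" using m by (intro mult_left_mono) auto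
    also have "\<dots> \<le> x / y" using that m by (simp add: field_simps) (smt (verit) mult_left_le)
    finally show ?thesis by (simp add: \<eta>_def power2_eq_square)
  qed
  have ratio2: "\<eta> \<le> (x / u) / (y / v)" if "m \<le> x" "m \<le> y" "m \<le> u" "m \<le> v" "x \<le> 1" "y \<le> 1" "u \<le> 1" "v \<le> 1" for x y u v
  proof -
    have "m * m \<le> x * v" using that m by (intro mult_mono) auto
    moreover have "u * y \<le> 1" using that m by (intro mult_le_one) auto
    ultimately have "\<eta> * (u * y) \<le> x * v"
      using mult_left_le[of "u * y" \<eta>] \<eta> by (simp add: \<eta>_def power2_eq_square)
    then show ?thesis using that m by (simp add: field_simps)
  qed
  have inv: "x / y \<le> 1 / \<eta>" if "\<eta> \<le> y / x" "x > 0" "y > 0" for x y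
    using that \<eta> by (simp add: field_simps)
  have s1: "sin a \<le> 1" "sin b \<le> 1" "sin c \<le> 1" "sin d \<le> 1" "sin (a + b) \<le> 1" "sin (c + d) \<le> 1"
    by simp_all
  have same: "ss / sd = sin c / sin d" "sd / ss = sin d / sin c" "sa / sq = sin a / sin b" "sq / sa = sin b / sin a"
    using nz by (simp_all add: sq_def ss_def sa_def sd_def)
  have low1: "\<eta> \<le> ss / sd" "\<eta> \<le> sd / ss" "\<eta> \<le> sa / sq" "\<eta> \<le> sq / sa"
    unfolding same by (rule ratio1; use sines in simp)+
  have low2: "\<eta> \<le> sq / ss" "\<eta> \<le> ss / sq" "\<eta> \<le> sd / sa" "\<eta> \<le> sa / sd"
    unfolding sq_def ss_def sa_def sd_def by (rule ratio2; use sines in simp)+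
  note bounds = low2(1) inv[OF low2(2) pos(1,2)] low1(1) inv[OF low1(2) pos(2,4)]
    low2(3) inv[OF low2(4) pos(4,3)] low1(3) inv[OF low1(4) pos(3,1)]
  have cP: "corner \<eta> Q P S (a + d - pi / 2)"
    by (rule corner_of_polar[where x = sq and y = ss and \<beta> = a and \<gamma> = "- d"])
      (use pos bounds in \<open>auto simp: val\<close>)
  have cS: "corner \<eta> P S R (pi / 2 - c - d)"
    by (rule corner_of_polar[where x = ss and y = sd and \<beta> = "pi - d" and \<gamma> = c])
      (use pos bounds RS in \<open>auto simp: val complex_eq_iff\<close>)
  have cR: "corner \<eta> S R Q (b + c - pi / 2)"
  proof (rule corner_of_polar[where x = sd and y = sa and \<beta> = "pi + c" and \<gamma> = "pi - b"])
    show "S - R = sd *\<^sub>R cis (pi + c)" using arg_cong[OF RS, of uminus] by (simp add: complex_eq_iff)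
    show "Q - R = sa *\<^sub>R cis (pi - b)" using arg_cong[OF RQ, of uminus] by (simp add: complex_eq_iff)
  qed (use pos bounds in auto)
  have cQ: "corner \<eta> R Q P (pi / 2 - a - b)"
    by (rule corner_of_polar[where x = sa and y = sq and \<beta> = "- b" and \<gamma> = "a - pi"])
      (use pos bounds RQ in \<open>auto simp: val complex_eq_iff\<close>)
  have pi2: "slack \<eta> < pi / 2" using slack_bounds(2)[OF \<eta>] pi_gt3 by linarith
  note small = small[folded \<eta>_def]
  have ne: "S \<noteq> P" "R \<noteq> S" "Q \<noteq> R" "P \<noteq> Q"
    using pos RS RQ by (auto simp: val)
  have q: "convex_quad P S R Q"
    unfolding convex_quad_def
    using corner_cross_pos[OF cS \<eta>(1)] corner_cross_pos[OF cR \<eta>(1)] corner_cross_pos[OF cQ \<eta>(1)]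
      corner_cross_pos[OF cP \<eta>(1)] small pi2 ne cross_cyc[of S P R] cross_cyc[of R S Q]
      cross_cyc[of Q R P] cross_cyc[of P Q S] by auto
  have "billiard_quad P S R Q"
  proof (cases "a + d - pi / 2 = 0 \<and> pi / 2 - c - d = 0 \<and> b + c - pi / 2 = 0 \<and> pi / 2 - a - b = 0")
    case True
    then have eq: "c = a" "d = b" by auto
    obtain \<rho> where "\<eta> \<le> \<rho>" "Q - P = \<rho> *\<^sub>R (\<i> * cis (a + d - pi / 2) * (S - P))"
      using cP by (auto simp: corner_def)
    moreover have "R - S = Q - P" using RS eq by (simp add: val sq_def sd_def)
    ultimately show ?thesis using True \<eta>(1) by (intro billiard_rectangle[OF q, of \<rho>]) auto
  next
    case False
    show ?thesis
      by (rule billiard_nonrectangular[OF \<eta> q cP cS cR cQ _ False small]) simp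
  qed
  then show ?thesis
    using has_path_of_billiard_quad q by (simp add: P_def S_def R_def Q_def)
qed

theorem theorem1:
  assumes "r \<in> quad_space" and "is_rectangle r"
  shows "\<exists>U. openin (top_of_set quad_space) U \<and> r \<in> U \<and>
             (\<forall>q \<in> U. has_periodic_billiard_path q)"
proof -
  obtain a b where r: "r = (a, b, a, b)" "0 < a" "0 < b" "a + b = pi / 2"
    using assms by (auto simp: quad_space_def is_rectangle_def)
  \<comment> \<open>Half angles leave room for perturbing \<open>a\<close> and \<open>b\<close>; the
    value 9/10 serves the sines of the sums, whose arguments stay near pi/2.\<close>
  define m where "m = min (9 / 10) (min (sin (a / 2)) (sin (b / 2)))"
  have m: "0 < m" "m \<le> 1" "m \<le> sin (a / 2)" "m \<le> sin (b / 2)" "m \<le> 9 / 10"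
    using r by (auto simp: m_def intro!: sin_gt_zero)
  then have s: "0 < slack (m\<^sup>2)" "slack (m\<^sup>2) \<le> 1 / 2000"
    using slack_bounds(1,2)[of "m\<^sup>2"] by (auto simp: power_le_one)
  \<comment> \<open>Coordinates within \<open>e\<close> stay between half of \<open>a\<close> or
    \<open>b\<close> and pi/2, where the sine increases. Each angle involves two coordinates, hence
    half of the slack.\<close>
  define e where "e = min (min (a / 2) (b / 2)) (slack (m\<^sup>2) / 2)"
  have e: "0 < e" "e \<le> a / 2" "e \<le> b / 2" "e \<le> slack (m\<^sup>2) / 2"
    using r s by (auto simp: e_def)
  define V where "V = {a - e<..<a + e} \<times> {b - e<..<b + e} \<times> {a - e<..<a + e} \<times> {b - e<..<b + e}"
  have "open V" unfolding V_def by (intro open_Times open_greaterThanLessThan)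
  then have "openin (top_of_set quad_space) (quad_space \<inter> V)" by (rule openin_open_Int)
  moreover have "r \<in> quad_space \<inter> V" using assms e r by (simp add: V_def)
  moreover have "has_periodic_billiard_path q" if "q \<in> quad_space \<inter> V" for q
  proof -
    obtain a' b' c' d' where q: "q = (a', b', c', d')" by (cases q)
    have V: "\<bar>a' - a\<bar> < e" "\<bar>b' - b\<bar> < e" "\<bar>c' - a\<bar> < e" "\<bar>d' - b\<bar> < e"
      using that by (auto simp: q V_def)
    have sin_ge: "m \<le> sin x" if "\<bar>x - y\<bar> < e" "y = a \<or> y = b" for x y
    proof -
      have "sin (y / 2) \<le> sin x"
        using that e r by (intro sin_monotone_2pi_le) (auto simp: abs_less_iff)
      then show ?thesis using that m by auto
    qed
    have sin_sum: "m \<le> sin x" if "\<bar>x - pi / 2\<bar> \<le> slack (m\<^sup>2)" for x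
    proof -
      have "cos (x - pi / 2) \<ge> 9 / 10" using that s by (intro cos_ge_nine_tenths) auto
      then show ?thesis using m by (simp add: cos_diff)
    qed
    have small: "\<bar>a' + d' - pi / 2\<bar> \<le> slack (m\<^sup>2)" "\<bar>pi / 2 - c' - d'\<bar> \<le> slack (m\<^sup>2)"
      "\<bar>b' + c' - pi / 2\<bar> \<le> slack (m\<^sup>2)" "\<bar>pi / 2 - a' - b'\<bar> \<le> slack (m\<^sup>2)"
      using V e r(4) by (simp_all add: abs_le_iff abs_less_iff)
    have "m \<le> sin a'" "m \<le> sin b'" "m \<le> sin c'" "m \<le> sin d'"
      using V by (auto intro: sin_ge)
    moreover have "m \<le> sin (a' + b')" "m \<le> sin (c' + d')"
      using small by (auto intro!: sin_sum)
    ultimately show ?thesis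
      unfolding q by (rule near_rectangle_has_path[OF m(1,2) _ _ _ _ _ _ small])
  qed
  ultimately show ?thesis by blast
qed

end
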